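(* For $B_2\subset\mathbb R^n$, $n\ge 1$, let $k$ be an integer satisfying $\frac n2<k\le n$. Assume that $\xi\in C^2(B_2\setminus\{0\})\cap L^\infty(B_2\setminus\{0\})$ and $$\lambda(D^2\xi)\in\overline{\Gamma}_k\quad\text{in } B_2\setminus\{0\}.$$ Then, for $\alpha=\frac{2k-n}{k}$, $\xi$ can be extended as a function in $C^{0,\alpha}(B_1)$ and, for any $0<a<2$, $$\|\xi\|_{C^{0,\alpha}(B_a)}\le C(n,a)\left(\sup_{B_2\setminus\{0\}}\xi-\inf_{B_2\setminus\{0\}}\xi\right),$$ where $C(n,a)$ is some positive constant depending only on $n$ and $a$.
   Context: $B_a\subset\mathbb R^n$ is the ball of radius $a$ centered at the origin. $D^2\xi$ is the Hessian of $\xi$ and $\lambda(D^2\xi)$ denotes its eigenvalues. For $1\le k\le n$, $\sigma_k(\lambda)=\sum_{1\le i_1<\cdots<i_k\le n}\lambda_{i_1}\cdots\lambda_{i_k}$ is the $k$-th elementary symmetric function; $\Gamma_k$ is the connected component of $\{\lambda\in\mathbb R^n\mid\sigma_k(\lambda)>0\}$ containing the positive cone $\Gamma_n=\{\lambda=(\lambda_1,\dots,\lambda_n)\mid\lambda_i>0 \text{ for all } i\}$, and $\overline\Gamma_k$ is its closure. $\|\cdot\|_{C^{0,\alpha}(B_a)}$ denotes the Hölder norm with exponent $\alpha$ on $B_a$, applied to the extended function.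
   Formalization: The case n = 1 is excluded (ξ = sgn x is a counterexample), and the norm estimate is stated for ξ − inf ξ instead of ξ, since it fails for nonzero constant ξ. *)

theory Defs
  imports "HOL-Analysis.Analysis"
begin

definition grad :: "(real ^ 'n \<Rightarrow> real) \<Rightarrow> real ^ 'n \<Rightarrow> real ^ 'n" where
  "grad f x = (\<chi> i. frechet_derivative f (at x) (axis i 1))"

definition hessian :: "(real ^ 'n \<Rightarrow> real) \<Rightarrow> real ^ 'n \<Rightarrow> real ^ 'n ^ 'n" where
  "hessian f x = jacobian (grad f) (at x)"

(* Class C^2 on an open set S. The derivatives are taken with respect to the full
   neighbourhood filter, so the definition is only meaningful for open S. *)
definition C2_on :: "(real ^ 'n \<Rightarrow> real) \<Rightarrow> (real ^ 'n) set \<Rightarrow> bool" where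
  "C2_on f S \<longleftrightarrow>
     (\<forall>x\<in>S. f differentiable (at x)) \<and>
     (\<forall>x\<in>S. grad f differentiable (at x)) \<and>
     continuous_on S (hessian f)"

(* l lists the eigenvalues of A with algebraic multiplicity: the characteristic polynomial
   of A splits with roots l $ i. For symmetric A such an l exists and is unique up to a
   permutation of the coordinates, under which sigma k and Gamma_cone k below are invariant. *)
definition is_eigenvalues :: "real ^ 'n ^ 'n \<Rightarrow> real ^ 'n \<Rightarrow> bool" where
  "is_eigenvalues A l \<longleftrightarrow> (\<forall>t. det (t *\<^sub>R mat 1 - A) = (\<Prod>i\<in>UNIV. t - l $ i))"

definition sigma :: "nat \<Rightarrow> real ^ 'n \<Rightarrow> real" where
  "sigma k l = (\<Sum>I | card I = k. \<Prod>i\<in>I. l $ i)"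

definition positive_cone :: "(real ^ 'n) set" where
  "positive_cone = {l. \<forall>i. l $ i > 0}"

(* The component containing the positive cone is picked out by the point (1, ..., 1);
   see Gamma_cone_component. *)
definition Gamma_cone :: "nat \<Rightarrow> (real ^ 'n) set" where
  "Gamma_cone k = connected_component_set {l. sigma k l > 0} (\<chi> i. 1)"

lemma sigma_pos:
  fixes l :: "real ^ 'n"
  assumes "k \<le> CARD('n)" "l \<in> positive_cone"
  shows "sigma k l > 0"
proof -
  obtain I :: "'n set" where I: "card I = k"
    using obtain_subset_with_card_n[OF assms(1)] by blast
  have fin: "finite {J :: 'n set. card J = k}" by simp
  have "(\<Prod>i\<in>J. l $ i) > 0" for J
    using assms(2) by (auto simp: positive_cone_def intro: prod_pos)
  then show ?thesis
    unfolding sigma_def using I by (intro sum_pos[OF fin]) auto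
qed

lemma Gamma_cone_component:
  assumes "k \<le> CARD('n)"
  shows "(Gamma_cone k :: (real ^ 'n) set) \<in> components {l. sigma k l > 0}"
    and "(positive_cone :: (real ^ 'n) set) \<subseteq> Gamma_cone k"
proof -
  let ?e = "(\<chi> i. 1) :: real ^ 'n"
  have e: "?e \<in> positive_cone" by (simp add: positive_cone_def)
  have sub: "(positive_cone :: (real ^ 'n) set) \<subseteq> {l. sigma k l > 0}"
    using sigma_pos[OF assms] by auto
  have "convex (positive_cone :: (real ^ 'n) set)"
  proof (rule convexI)
    fix x y :: "real ^ 'n" and u v :: real
    assume *: "x \<in> positive_cone" "y \<in> positive_cone" "0 \<le> u" "0 \<le> v" "u + v = 1"
    have "u * x $ i + v * y $ i > 0" for i
      using * convex_bound_lt[of "- (x $ i)" 0 "- (y $ i)" u v]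
      by (simp add: positive_cone_def)
    then show "u *\<^sub>R x + v *\<^sub>R y \<in> positive_cone" by (simp add: positive_cone_def)
  qed
  then have "connected (positive_cone :: (real ^ 'n) set)" by (rule convex_connected)
  then show "(positive_cone :: (real ^ 'n) set) \<subseteq> Gamma_cone k"
    unfolding Gamma_cone_def by (intro connected_component_maximal e sub)
  show "(Gamma_cone k :: (real ^ 'n) set) \<in> components {l. sigma k l > 0}"
    unfolding Gamma_cone_def components_def using e sub by blast
qed

definition holder_space :: "real \<Rightarrow> 'a::metric_space set \<Rightarrow> ('a \<Rightarrow> real) set" where
  "holder_space \<alpha> S = {f. bounded (f ` S) \<and>
     (\<exists>M. \<forall>x\<in>S. \<forall>y\<in>S. \<bar>f x - f y\<bar> \<le> M * dist x y powr \<alpha>)}"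

(* The full norm (sup norm plus seminorm). The suprema are over the reals, hence only
   meaningful for members of holder_space on a set with at least two points. *)
definition holder_norm :: "real \<Rightarrow> 'a::metric_space set \<Rightarrow> ('a \<Rightarrow> real) \<Rightarrow> real" where
  "holder_norm \<alpha> S f = (SUP x\<in>S. \<bar>f x\<bar>) +
     Sup {\<bar>f x - f y\<bar> / dist x y powr \<alpha> | x y. x \<in> S \<and> y \<in> S \<and> x \<noteq> y}"

end

theory Submission
  imports Defs "HOL-Computational_Algebra.Fundamental_Theorem_Algebra"
begin

text \<open>
  Everything rests on one linear consequence of the hypothesis. Put
  $\theta = (n-k)/(k(n-1))$, so that $\alpha = 2 - n/k = 1 - (n-1)\theta$. The function
  $|x|^{\alpha}$ has Hessian eigenvalues proportional to $(\alpha-1, 1, \ldots, 1)$, a boundary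
  point of the cone, and the supporting hyperplane of the cone there says that
  $\lambda_i + \theta \sum_{j \neq i} \lambda_j \ge 0$ for every $\lambda \in \overline\Gamma_k$
  and every $i$ (\<open>closure_Gamma_cone_linear\<close>). It follows that
  $(1-\theta)\, e^T D^2\xi\, e + \theta\, \Delta\xi \ge 0$ for every unit vector $e$
  (\<open>Gamma_cone_quadratic_form\<close>). This property, recorded as \<open>cone_subsolution\<close>, and the
  bounded oscillation of $\xi$ are all that the estimates use.

  For the algebraic inequality, the path from $\lambda$ that averages two coordinates stays inside
  $\{\sigma_k > 0\}$, because the coefficient of $\lambda_x\lambda_y$ in $\sigma_k$ is nonnegative
  on $\Gamma_k$. Repeated averaging reduces the claim to vectors $(\lambda_i, b, \ldots, b)$, where
  $\sigma_k$ is explicit. The sign of that coefficient comes from hyperbolicity: $\sigma_k$ does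
  not vanish when all arguments lie in the upper half plane (\<open>esym_stable\<close>), so
  $t \mapsto \sigma_k(\lambda + t e)$ has only real roots for every positive $e$, and on $\Gamma_k$
  all these roots are negative, hence all coefficients positive.

  For the estimate, compare $\xi$ on a ball $B_R(y)$ with
  $\xi(y) + N (|x-y|/R)^{\alpha}$, where $N$ is the oscillation. The comparison function agrees
  with $\xi$ at $y$, dominates it on the boundary sphere, and with a slightly smaller exponent is a
  strict supersolution of the linear inequality in which $e$ is the radial direction at $x$. Only
  the origin, where $\xi$ has no Hessian, is in the way. It is avoided by adding a small
  multiple of $|x-y|^{2a} \ln(|x-y| / d(x))$, where $2a < \alpha$ is the exponent in use and $d$ the
  distance to the line through $0$ and $y$. That term is $+\infty$ on this line away from $y$, and
  it costs at most a bounded multiple of $\theta |x-y|^{2a-2}$, which the strictness absorbs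
  (\<open>barrier_strict_supersolution\<close>). Off the line the bound
  $\xi(x) - \xi(y) \le N (|x-y|/R)^{\alpha}$ follows by letting the extra term and the loss in the
  exponent tend to zero, and at the remaining points $x \neq 0$ of the line by continuity of
  $\xi$. Exchanging $x$ and $y$ gives the Hoelder bound on the punctured ball, with constants
  that do not see the puncture, and so $\xi$ extends continuously and with the same bound to $0$.
\<close>

section \<open>Stability of elementary symmetric polynomials\<close>

text \<open>
  Elementary symmetric polynomials of the variables indexed by a set, over any commutative ring:
  the set lets variables be removed one at a time, and the ring is taken to be the reals, the
  complex numbers, and the real polynomials in one variable.
\<close>

definition esym :: "'i set \<Rightarrow> nat \<Rightarrow> ('i \<Rightarrow> 'a::comm_ring_1) \<Rightarrow> 'a" where
  "esym S k v = (\<Sum>I | I \<subseteq> S \<and> card I = k. \<Prod>i\<in>I. v i)"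

lemma sigma_eq_esym: "sigma k l = esym UNIV k (\<lambda>i. l $ i)"
  by (simp add: sigma_def esym_def)

lemma esym_0 [simp]: "finite S \<Longrightarrow> esym S 0 v = 1"
proof -
  assume S: "finite S"
  then have "{I. I \<subseteq> S \<and> card I = 0} = {{}}"
    by (auto simp: finite_subset)
  then show ?thesis by (simp add: esym_def)
qed

lemma esym_cong: "(\<And>i. i \<in> S \<Longrightarrow> v i = w i) \<Longrightarrow> esym S k v = esym S k w"
  unfolding esym_def by (intro sum.cong refl prod.cong) auto

lemma esym_insert:
  assumes S: "finite S" "x \<notin> S"
  shows "esym (insert x S) (Suc k) v = esym S (Suc k) v + v x * esym S k v"
proof -
  let ?A = "{I. I \<subseteq> S \<and> card I = Suc k}" and ?B = "{I. I \<subseteq> S \<and> card I = k}"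
  have fin: "finite ?A" "finite ?B" using S(1) by auto
  have eq: "{I. I \<subseteq> insert x S \<and> card I = Suc k} = ?A \<union> insert x ` ?B"
  proof (intro equalityI subsetI)
    fix I assume I: "I \<in> {I. I \<subseteq> insert x S \<and> card I = Suc k}"
    show "I \<in> ?A \<union> insert x ` ?B"
    proof (cases "x \<in> I")
      case True
      then have "I = insert x (I - {x})" by auto
      moreover have "finite I" using I S(1) by (auto intro: finite_subset)
      ultimately show ?thesis using I True by (intro UnI2 image_eqI[where x = "I - {x}"]) auto
    next
      case False
      then show ?thesis using I by auto
    qed
  next
    fix I assume "I \<in> ?A \<union> insert x ` ?B"
    moreover have "card (insert x J) = Suc k" if "J \<in> ?B" for J
      using that S by (subst card_insert_disjoint) (auto intro: finite_subset)
    ultimately show "I \<in> {I. I \<subseteq> insert x S \<and> card I = Suc k}" by auto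
  qed
  have disj: "?A \<inter> insert x ` ?B = {}" using S(2) by auto
  have inj: "inj_on (insert x) ?B"
    using S(2) by (intro inj_onI) (metis (no_types, lifting) insert_ident mem_Collect_eq subsetD)
  have ins: "(\<Prod>i\<in>insert x J. v i) = v x * (\<Prod>i\<in>J. v i)" if "J \<in> ?B" for J
    using that S by (subst prod.insert) (auto intro: finite_subset)
  show ?thesis
    unfolding esym_def eq
    by (subst sum.union_disjoint[OF fin(1) finite_imageI[OF fin(2)] disj])
       (simp add: sum.reindex[OF inj] ins sum_distrib_left)
qed

lemma esym_remove:
  assumes "finite S" "x \<in> S"
  shows "esym S (Suc k) v = esym (S - {x}) (Suc k) v + v x * esym (S - {x}) k v"
  using esym_insert[of "S - {x}" x k v] assms by (simp add: insert_absorb)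

text \<open>
  Every monomial of degree $k+1$ is counted once for each of its $k+1$ variables.
\<close>

lemma esym_euler:
  assumes S: "finite S"
  shows "of_nat (Suc k) * esym S (Suc k) v = (\<Sum>x\<in>S. v x * esym (S - {x}) k v)"
proof -
  let ?A = "{I. I \<subseteq> S \<and> card I = Suc k}"
  have fin: "finite ?A" using S by auto
  have *: "v x * esym (S - {x}) k v = (\<Sum>I | I \<in> ?A \<and> x \<in> I. \<Prod>i\<in>I. v i)" if x: "x \<in> S" for x
  proof -
    have "bij_betw (insert x) {I. I \<subseteq> S - {x} \<and> card I = k} {I. I \<in> ?A \<and> x \<in> I}"
    proof (rule bij_betw_byWitness[where f' = "\<lambda>I. I - {x}"])
      show "insert x ` {I. I \<subseteq> S - {x} \<and> card I = k} \<subseteq> {I \<in> ?A. x \<in> I}"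
      proof safe
        fix J assume J: "J \<subseteq> S - {x}" "k = card J"
        then have "x \<notin> J" "finite J" using S by (auto intro: finite_subset)
        then show "card (insert x J) = Suc (card J)" by simp
      qed (use x in auto)
      show "(\<lambda>I. I - {x}) ` {I \<in> ?A. x \<in> I} \<subseteq> {I. I \<subseteq> S - {x} \<and> card I = k}"
        using S by (auto simp: card_Diff_singleton)
    qed auto
    moreover have "(\<Prod>i\<in>insert x J. v i) = v x * (\<Prod>i\<in>J. v i)"
      if "J \<in> {I. I \<subseteq> S - {x} \<and> card I = k}" for J
      using that S by (subst prod.insert) (auto intro: finite_subset)
    ultimately show ?thesis
      unfolding esym_def sum_distrib_left by (subst sum.reindex_bij_betw[symmetric]) auto
  qed
  have "(\<Sum>x\<in>S. v x * esym (S - {x}) k v) = (\<Sum>x\<in>S. \<Sum>I | I \<in> ?A \<and> x \<in> I. \<Prod>i\<in>I. v i)"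
    by (intro sum.cong refl *)
  also have "\<dots> = (\<Sum>I\<in>?A. \<Sum>x | x \<in> S \<and> x \<in> I. \<Prod>i\<in>I. v i)"
    using sum.swap_restrict[OF S fin, where g = "\<lambda>x I. \<Prod>i\<in>I. v i" and R = "\<lambda>x I. x \<in> I"] by simp
  also have "\<dots> = (\<Sum>I\<in>?A. of_nat (Suc k) * (\<Prod>i\<in>I. v i))"
  proof (intro sum.cong refl)
    fix I assume I: "I \<in> ?A"
    then have "{x. x \<in> S \<and> x \<in> I} = I" by auto
    then show "(\<Sum>x | x \<in> S \<and> x \<in> I. \<Prod>i\<in>I. v i) = of_nat (Suc k) * (\<Prod>i\<in>I. v i)"
      using I by simp
  qed
  finally show ?thesis by (simp add: esym_def sum_distrib_left)
qed

lemma Im_inverse_pos: "Im z > 0 \<Longrightarrow> Im (inverse z) < 0"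
  by (cases z) (simp add: divide_neg_pos add_nonneg_pos)

lemma Im_inverse_neg: "Im z < 0 \<Longrightarrow> Im (inverse z) > 0"
  by (cases z) (simp add: divide_neg_pos add_nonneg_pos)

text \<open>
  In the form on the right, the value lies in the upper half plane whenever $a/b$ and $z$ do.
\<close>

lemma parallel_sum:
  fixes a b z :: complex
  assumes "a \<noteq> 0" "b \<noteq> 0" "z \<noteq> 0" "a + z * b \<noteq> 0"
  shows "z * a / (a + z * b) = inverse (inverse (a / b) + inverse z)"
proof -
  have "inverse (a / b) + inverse z = (a + z * b) / (z * a)"
    using assms by (simp add: divide_simps mult.commute)
  then show ?thesis by simp
qed

text \<open>
  The ratio $\sigma_{k+1}/\sigma_k$ takes values in the upper half plane. In the induction step,
  Euler's identity writes $(k+2)\,\sigma_{k+2}/\sigma_{k+1}$ as a sum over the variables $z_x$ of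
  the parallel sums of $z_x$ and the ratio $\sigma_{k+1}/\sigma_k$ of the other variables; each of
  these terms lies in the upper half plane.
\<close>

lemma esym_stable_aux:
  fixes z :: "'i \<Rightarrow> complex"
  assumes z: "\<And>i. Im (z i) > 0"
  shows "finite S \<Longrightarrow> Suc k \<le> card S \<Longrightarrow>
    esym S k z \<noteq> 0 \<and> esym S (Suc k) z \<noteq> 0 \<and> Im (esym S (Suc k) z / esym S k z) > 0"
proof (induction k arbitrary: S)
  case 0
  have "esym S 1 z = (\<Sum>x\<in>S. z x)" using esym_euler[OF 0(1), of 0 z] 0(1) by simp
  moreover have "(\<Sum>x\<in>S. Im (z x)) > 0" using 0 z by (intro sum_pos) auto
  ultimately have "Im (esym S 1 z) > 0" by simp
  then show ?case using 0 by auto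
next
  case (Suc k)
  have ne: "esym S (Suc k) z \<noteq> 0" using Suc.IH[of S] Suc.prems by auto
  have pos: "Im (z x * esym (S - {x}) (Suc k) z / esym S (Suc k) z) > 0" if x: "x \<in> S" for x
  proof -
    let ?a = "esym (S - {x}) (Suc k) z" and ?b = "esym (S - {x}) k z"
    have "card (S - {x}) \<ge> Suc k" using Suc.prems x by simp
    then have ab: "?a \<noteq> 0" "?b \<noteq> 0" "Im (?a / ?b) > 0"
      using Suc.IH[of "S - {x}"] Suc.prems by auto
    have zx: "z x \<noteq> 0" using z[of x] by auto
    have eq: "esym S (Suc k) z = ?a + z x * ?b" by (rule esym_remove[OF Suc.prems(1) x])
    have "z x * ?a / esym S (Suc k) z = inverse (inverse (?a / ?b) + inverse (z x))"
      using parallel_sum[OF ab(1,2) zx] ne unfolding eq .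
    moreover have "Im (inverse (?a / ?b) + inverse (z x)) < 0"
      using Im_inverse_pos[OF ab(3)] Im_inverse_pos[OF z[of x]] by (simp del: inverse_divide)
    ultimately show ?thesis using Im_inverse_neg by metis
  qed
  have "of_nat (Suc (Suc k)) * esym S (Suc (Suc k)) z / esym S (Suc k) z =
     (\<Sum>x\<in>S. z x * esym (S - {x}) (Suc k) z / esym S (Suc k) z)"
    using esym_euler[OF Suc.prems(1), of "Suc k" z] by (simp add: sum_divide_distrib)
  moreover have "Im (\<Sum>x\<in>S. z x * esym (S - {x}) (Suc k) z / esym S (Suc k) z) > 0"
    unfolding Im_sum using Suc.prems pos by (intro sum_pos) auto
  ultimately have "Im (of_nat (Suc (Suc k)) * (esym S (Suc (Suc k)) z / esym S (Suc k) z)) > 0"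
    by simp
  moreover have "Im (of_nat m * w) = of_nat m * Im w" for m w by simp
  ultimately have *: "Im (esym S (Suc (Suc k)) z / esym S (Suc k) z) > 0"
    by (metis of_nat_0_less_iff zero_less_Suc zero_less_mult_pos)
  then have "esym S (Suc (Suc k)) z \<noteq> 0" by auto
  then show ?case using * ne by blast
qed

lemma esym_stable:
  fixes z :: "'i \<Rightarrow> complex"
  assumes "\<And>i. Im (z i) > 0" "finite S" "k \<le> card S"
  shows "esym S k z \<noteq> 0"
  using esym_stable_aux[of z S "k - 1"] assms by (cases k) auto

section \<open>Hyperbolicity on the cone\<close>

abbreviation complex_poly :: "real poly \<Rightarrow> complex poly" where
  "complex_poly \<equiv> map_poly complex_of_real"

lemma complex_poly_mult: "complex_poly (p * q) = complex_poly p * complex_poly q"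
  by (rule poly_eqI) (simp add: coeff_map_poly coeff_mult)

lemma complex_poly_add: "complex_poly (p + q) = complex_poly p + complex_poly q"
  by (rule poly_eqI) (simp add: coeff_map_poly)

lemma poly_complex_poly_of_real: "poly (complex_poly p) (of_real x) = of_real (poly p x)"
  by (induction p) (simp_all add: map_poly_pCons)

text \<open>
  Such a polynomial is a positive constant times a product of factors $t + r$ with $r > 0$.
\<close>

lemma coeffs_pos_if_roots_neg:
  fixes p :: "real poly"
  assumes "lead_coeff p > 0"
    and "\<And>z. poly (complex_poly p) z = 0 \<Longrightarrow> Im z = 0 \<and> Re z < 0"
  shows "j \<le> degree p \<Longrightarrow> coeff p j > 0"
  using assms
proof (induction "degree p" arbitrary: p j)
  case 0
  then show ?case by simp
next
  case (Suc d)
  let ?c = complex_poly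
  have "degree (?c p) > 0" using Suc.hyps(2) by (simp add: degree_map_poly)
  then obtain z where z: "poly (?c p) z = 0"
    using alg_closed_imp_poly_has_root by blast
  then have "Im z = 0" and rneg: "Re z < 0" using Suc.prems(3) by auto
  then have "z = of_real (Re z)" by (simp add: complex_eq_iff)
  then have "poly p (Re z) = 0" using z poly_complex_poly_of_real[of p "Re z"] by simp
  then obtain q where q: "p = [:- Re z, 1:] * q" by (metis poly_eq_0_iff_dvd dvdE)
  have q0: "q \<noteq> 0" using q Suc.prems(2) by auto
  have dq: "d = degree q" using Suc.hyps(2) q0 degree_mult_eq[of "[:- Re z, 1:]" q] unfolding q by simp
  have lq: "lead_coeff q > 0" using Suc.prems(2) unfolding q lead_coeff_mult by simp
  have rq: "Im w = 0 \<and> Re w < 0" if "poly (?c q) w = 0" for w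
  proof -
    have "poly (?c p) w = 0" unfolding q complex_poly_mult by (simp add: that)
    then show ?thesis using Suc.prems(3) by blast
  qed
  have IH: "coeff q i > 0" if "i \<le> d" for i
    using Suc.hyps(1)[OF dq _ lq rq] that dq by auto
  have nn: "coeff q i \<ge> 0" for i
    using IH[of i] dq by (cases "i \<le> d") (auto simp: coeff_eq_0)
  have cp: "coeff p j = - Re z * coeff q j + (case j of 0 \<Rightarrow> 0 | Suc i \<Rightarrow> coeff q i)"
    unfolding q by (simp add: mult_pCons_left coeff_pCons)
  show ?case
  proof (cases "j \<le> d")
    case True
    have "- Re z * coeff q j > 0" using IH[OF True] rneg by (simp add: mult_neg_pos)
    moreover have "(case j of 0 \<Rightarrow> 0 | Suc i \<Rightarrow> coeff q i) \<ge> 0" using nn by (simp split: nat.split)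
    ultimately show ?thesis unfolding cp by linarith
  next
    case False
    then have "j = Suc d" using Suc.prems(1) Suc.hyps(2) by simp
    then show ?thesis using Suc.prems(2) Suc.hyps(2) by simp
  qed
qed

lemma complex_poly_sum: "complex_poly (sum f A) = (\<Sum>x\<in>A. complex_poly (f x))"
  by (induction A rule: infinite_finite_induct) (simp_all add: complex_poly_add)

lemma complex_poly_prod: "complex_poly (prod f A) = (\<Prod>x\<in>A. complex_poly (f x))"
  by (induction A rule: infinite_finite_induct) (simp_all add: complex_poly_mult)

text \<open>
  The polynomial $t \mapsto \sigma_k(l + t e)$.
\<close>

definition line_poly :: "nat \<Rightarrow> real ^ 'n \<Rightarrow> real ^ 'n \<Rightarrow> real poly" where
  "line_poly k l e = esym UNIV k (\<lambda>i. [:l $ i, e $ i:])"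

lemma poly_line_poly: "poly (line_poly k l e) t = sigma k (l + t *\<^sub>R e)"
  by (simp add: line_poly_def sigma_def esym_def poly_sum poly_prod)

lemma coeff_0_line_poly: "coeff (line_poly k l e) 0 = sigma k l"
  using poly_line_poly[of k l e 0] by (simp add: poly_0_coeff_0)

lemma degree_prod_linear:
  fixes a b :: "'i \<Rightarrow> real"
  shows "finite I \<Longrightarrow> degree (\<Prod>i\<in>I. [:a i, b i:]) \<le> card I \<and>
    coeff (\<Prod>i\<in>I. [:a i, b i:]) (card I) = (\<Prod>i\<in>I. b i)"
proof (induction I rule: finite_induct)
  case (insert x I)
  let ?p = "\<Prod>i\<in>I. [:a i, b i:]"
  have "degree ([:a x, b x:] * ?p) \<le> Suc (card I)"
    using degree_mult_le[of "[:a x, b x:]" ?p] insert.IH by (simp split: if_splits)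
  moreover have "coeff ([:a x, b x:] * ?p) (Suc (card I)) = b x * (\<Prod>i\<in>I. b i)"
    using insert.IH by (simp add: coeff_eq_0)
  ultimately show ?case using insert.hyps by simp
qed auto

lemma degree_line_poly_le: "degree (line_poly k l e) \<le> k"
  unfolding line_poly_def esym_def
proof (intro degree_sum_le)
  fix I :: "'a set" assume "I \<in> {I. I \<subseteq> UNIV \<and> card I = k}"
  then show "degree (\<Prod>i\<in>I. [:l $ i, e $ i:]) \<le> k"
    using degree_prod_linear[OF finite, of "\<lambda>i. l $ i" "\<lambda>i. e $ i" I] by auto
qed simp

lemma coeff_line_poly_top: "coeff (line_poly k l e) k = sigma k e"
  unfolding line_poly_def esym_def sigma_def coeff_sum
  using degree_prod_linear[OF finite] by (intro sum.cong) auto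

lemma poly_complex_line_poly:
  "poly (complex_poly (line_poly k l e)) z = esym UNIV k (\<lambda>i. of_real (l $ i) + z * of_real (e $ i))"
  by (simp add: line_poly_def esym_def complex_poly_sum complex_poly_prod poly_sum poly_prod map_poly_pCons)

text \<open>
  A root in the open upper half plane would be a zero of $\sigma_k$ at a point all of whose
  coordinates lie there; roots in the lower half plane are conjugates of such roots.
\<close>

lemma line_poly_roots_real:
  fixes l e :: "real ^ 'n"
  assumes k: "k \<le> CARD('n)" and e: "e \<in> positive_cone"
    and root: "poly (complex_poly (line_poly k l e)) z = 0"
  shows "Im z = 0"
proof -
  have no: "poly (complex_poly (line_poly k l e)) w \<noteq> 0" if "Im w > 0" for w
    unfolding poly_complex_line_poly
    using that e k by (intro esym_stable) (auto simp: positive_cone_def)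
  have "poly (complex_poly (line_poly k l e)) (cnj z) = cnj (poly (complex_poly (line_poly k l e)) z)"
    unfolding poly_complex_line_poly esym_def by (simp add: cnj_sum cnj_prod)
  then show ?thesis using no[of z] no[of "cnj z"] root by (cases "Im z" "0::real" rule: linorder_cases) auto
qed

text \<open>
  Nonnegative coefficients with a positive constant term exclude roots in $[0, \infty)$. Since
  all roots are real, they are negative, and then no coefficient can vanish. This is the step that
  makes the set of $l$ with positive coefficients relatively closed in $\{\sigma_k > 0\}$.
\<close>

lemma coeff_line_poly_pos:
  fixes l e :: "real ^ 'n"
  assumes k: "k \<le> CARD('n)" and e: "e \<in> positive_cone" and pos: "sigma k l > 0"
    and nn: "\<And>i. coeff (line_poly k l e) i \<ge> 0" and j: "j \<le> k"
  shows "coeff (line_poly k l e) j > 0"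
proof -
  let ?p = "line_poly k l e"
  have top: "coeff ?p k > 0" using sigma_pos[OF k e] by (simp add: coeff_line_poly_top)
  then have deg: "degree ?p = k" using degree_line_poly_le le_degree by (metis less_irrefl antisym)
  have "Im z = 0 \<and> Re z < 0" if z: "poly (complex_poly ?p) z = 0" for z
  proof -
    have im: "Im z = 0" using line_poly_roots_real[OF k e z] .
    then have "z = of_real (Re z)" by (simp add: complex_eq_iff)
    then have r: "poly ?p (Re z) = 0" using z poly_complex_poly_of_real[of ?p "Re z"] by simp
    have "poly ?p t > 0" if "t \<ge> 0" for t
    proof -
      have "0 < coeff ?p 0 * t ^ 0" using pos by (simp add: coeff_0_line_poly)
      also have "\<dots> \<le> (\<Sum>i\<le>degree ?p. coeff ?p i * t ^ i)"
        using nn that by (intro member_le_sum) auto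
      finally show ?thesis by (simp add: poly_altdef)
    qed
    then have "Re z < 0" using r by (metis less_irrefl not_le)
    then show ?thesis using im by simp
  qed
  then show ?thesis using coeffs_pos_if_roots_neg[of ?p j] top deg j by auto
qed

lemma continuous_coeff_prod_linear:
  fixes f g :: "'i \<Rightarrow> 'a::topological_space \<Rightarrow> real"
  assumes "\<And>i. continuous_on UNIV (f i)" "\<And>i. continuous_on UNIV (g i)"
  shows "finite I \<Longrightarrow> continuous_on UNIV (\<lambda>x. coeff (\<Prod>i\<in>I. [:f i x, g i x:]) j)"
proof (induction I arbitrary: j rule: finite_induct)
  case (insert y I)
  then show ?case
    using assms by (cases j) (auto intro!: continuous_intros simp: coeff_pCons)
qed simp

lemma continuous_coeff_line_poly:
  fixes f g :: "'a::topological_space \<Rightarrow> real ^ 'n"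
  assumes "continuous_on UNIV f" "continuous_on UNIV g"
  shows "continuous_on UNIV (\<lambda>x. coeff (line_poly k (f x) (g x)) j)"
  unfolding line_poly_def esym_def coeff_sum
  by (intro continuous_on_sum continuous_coeff_prod_linear continuous_intros assms finite)

text \<open>
  The $l$ with all coefficients positive form an open set, and on $\{\sigma_k > 0\}$ it
  coincides with the closed set where they are nonnegative. The connected set $\Gamma_k$ meets it
  at $(1, \ldots, 1)$ and hence lies inside it.
\<close>

lemma coeff_line_poly_pos_Gamma_cone:
  fixes l e :: "real ^ 'n"
  assumes k: "k \<le> CARD('n)" and e: "e \<in> positive_cone" and l: "l \<in> Gamma_cone k" and j: "j \<le> k"
  shows "coeff (line_poly k l e) j > 0"
proof -
  let ?one = "(\<chi> i. 1) :: real ^ 'n"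
  let ?V = "{l. \<forall>j\<le>k. coeff (line_poly k l e) j > 0}"
  let ?W = "{l. \<forall>j. coeff (line_poly k l e) j \<ge> 0}"
  have cont: "continuous_on UNIV (\<lambda>l. coeff (line_poly k l e) j)" for j
    by (intro continuous_coeff_line_poly continuous_intros)
  have "?V = (\<Inter>j\<in>{..k}. {l. coeff (line_poly k l e) j > 0})" by auto
  moreover have "open {l. coeff (line_poly k l e) j > 0}" for j
    using open_Collect_less[OF continuous_on_const cont] .
  ultimately have V: "open ?V" by auto
  have "?W = (\<Inter>j. {l. coeff (line_poly k l e) j \<ge> 0})" by auto
  moreover have "closed {l. coeff (line_poly k l e) j \<ge> 0}" for j
    using closed_Collect_le[OF continuous_on_const cont] .
  ultimately have W: "closed ?W" by auto
  have VW: "?V \<subseteq> ?W"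
  proof safe
    fix l j assume "\<forall>j\<le>k. 0 < coeff (line_poly k l e) j"
    then show "0 \<le> coeff (line_poly k l e) j"
      using coeff_eq_0[of "line_poly k l e" j] degree_line_poly_le[of k l e] by (cases "j \<le> k") (auto intro: less_imp_le)
  qed
  have sub: "Gamma_cone k \<subseteq> {l. sigma k l > 0}"
    unfolding Gamma_cone_def by (rule connected_component_subset)
  have WV: "l \<in> ?V" if "l \<in> ?W" "l \<in> Gamma_cone k" for l
    using coeff_line_poly_pos[OF k e, of l] that sub by auto
  have one: "?one \<in> positive_cone" by (simp add: positive_cone_def)
  then have oneG: "?one \<in> Gamma_cone k" using Gamma_cone_component(2)[OF k] by auto
  have "?one \<in> ?W"
  proof safe
    fix j
    have "0 \<le> coeff (\<Prod>i\<in>I. [:1, e $ i:]) j" for I :: "'n set"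
    proof (induction I arbitrary: j rule: finite_induct[OF finite])
      case (2 x I)
      have "0 < e $ x" using e by (auto simp: positive_cone_def)
      then show ?case using 2 by (cases j) (auto simp: coeff_pCons)
    qed simp
    then show "0 \<le> coeff (line_poly k ?one e) j"
      unfolding line_poly_def esym_def coeff_sum by (intro sum_nonneg) simp
  qed
  then have oneV: "?one \<in> ?V" using WV oneG by blast
  have conn: "connected (Gamma_cone k :: (real ^ 'n) set)" unfolding Gamma_cone_def by simp
  have "?V \<inter> (- ?W) \<inter> Gamma_cone k = {}" using VW by blast
  moreover have "Gamma_cone k \<subseteq> ?V \<union> - ?W" using WV by blast
  ultimately have "- ?W \<inter> Gamma_cone k = {}"
    using connectedD[OF conn V open_Compl[OF W]] oneV oneG by blast
  then show ?thesis using WV[of l] l j by blast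
qed

lemma coeff_line_poly_nonneg_Gamma_cone:
  fixes l e :: "real ^ 'n"
  assumes k: "k \<le> CARD('n)" and e: "\<And>i. e $ i \<ge> 0" and l: "l \<in> Gamma_cone k"
  shows "coeff (line_poly k l e) j \<ge> 0"
proof (cases "j \<le> k")
  case True
  let ?e = "\<lambda>s::real. e + s *\<^sub>R (\<chi> i. 1)"
  have "continuous_on UNIV (\<lambda>s. coeff (line_poly k l (?e s)) j)"
    by (intro continuous_coeff_line_poly continuous_intros)
  then have "isCont (\<lambda>s. coeff (line_poly k l (?e s)) j) 0"
    by (simp add: continuous_on_eq_continuous_at)
  then have "((\<lambda>s. coeff (line_poly k l (?e s)) j) \<longlongrightarrow> coeff (line_poly k l (?e 0)) j) (at 0)"
    by (rule isContD)
  then have "((\<lambda>s. coeff (line_poly k l (?e s)) j) \<longlongrightarrow> coeff (line_poly k l (?e 0)) j) (at_right 0)"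
    by (rule filterlim_mono) (auto simp: at_le)
  moreover have "\<forall>\<^sub>F s in at_right 0. coeff (line_poly k l (?e s)) j \<ge> 0"
    using eventually_at_right_less[of 0]
  proof eventually_elim
    case (elim s)
    have "?e s \<in> positive_cone" using e elim by (auto simp: positive_cone_def add_nonneg_pos)
    then show ?case using coeff_line_poly_pos_Gamma_cone[OF k _ l True] by (simp add: less_imp_le)
  qed
  ultimately have "coeff (line_poly k l (?e 0)) j \<ge> 0"
    by (intro tendsto_lowerbound) auto
  then show ?thesis by simp
next
  case False
  then show ?thesis using degree_line_poly_le[of k l e] by (simp add: coeff_eq_0)
qed

section \<open>A supporting hyperplane of the cone\<close>

lemma esym_two:
  assumes S: "finite S" "x \<in> S" "y \<in> S" "x \<noteq> y"
  shows "esym S (Suc (Suc k)) v = esym (S - {x, y}) (Suc (Suc k)) v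
     + (v x + v y) * esym (S - {x, y}) (Suc k) v + v x * v y * esym (S - {x, y}) k v"
proof -
  have "S - {x} - {y} = S - {x, y}" by auto
  then show ?thesis
    using esym_remove[OF S(1,2), of "Suc k" v] esym_remove[of "S - {x}" y _ v] S
    by (simp add: algebra_simps)
qed

lemma esym_const_poly:
  fixes f :: "'i \<Rightarrow> real"
  shows "esym S k (\<lambda>i. [:f i:]) = [:esym S k f:]"
proof -
  have "(\<Sum>I\<in>A. [:g I:]) = [:sum g A:]" for A and g :: "'i set \<Rightarrow> real"
    by (induction A rule: infinite_finite_induct) simp_all
  moreover have "(\<Prod>i\<in>I. [:f i:]) = [:prod f I:]" for I
    by (induction I rule: infinite_finite_induct) simp_all
  ultimately show ?thesis unfolding esym_def by simp
qed

text \<open>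
  The mixed second derivative of $\sigma_k$ in two coordinates, found as the coefficient of $t^2$
  on the line in direction $e_x + e_y$.
\<close>

lemma esym_two_smaller_nonneg:
  fixes l :: "real ^ 'n"
  assumes k: "Suc (Suc k) \<le> CARD('n)" and l: "l \<in> Gamma_cone (Suc (Suc k))" and xy: "x \<noteq> y"
  shows "esym (UNIV - {x, y}) k (\<lambda>i. l $ i) \<ge> 0"
proof -
  let ?S = "UNIV - {x, y}" and ?e = "axis x 1 + axis y 1 :: real ^ 'n"
  have "esym ?S m (\<lambda>i. [:l $ i, ?e $ i:]) = [:esym ?S m (\<lambda>i. l $ i):]" for m
    unfolding esym_const_poly[symmetric] by (rule esym_cong) (auto simp: axis_def)
  then have "coeff (line_poly (Suc (Suc k)) l ?e) 2 = esym ?S k (\<lambda>i. l $ i)"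
    using xy unfolding line_poly_def
    by (subst esym_two[of UNIV x y]) (simp_all add: axis_def coeff_pCons numeral_2_eq_2)
  moreover have "coeff (line_poly (Suc (Suc k)) l ?e) 2 \<ge> 0"
    by (rule coeff_line_poly_nonneg_Gamma_cone[OF k _ l]) (simp add: axis_def)
  ultimately show ?thesis by simp
qed

definition average_pair :: "'n \<Rightarrow> 'n \<Rightarrow> real ^ 'n \<Rightarrow> real ^ 'n" where
  "average_pair x y l = (\<chi> i. if i = x \<or> i = y then (l $ x + l $ y) / 2 else l $ i)"

text \<open>
  With the sum of two coordinates fixed, $\sigma_k$ is an affine function of their product with
  nonnegative slope, and the product grows as the coordinates approach each other. So $\sigma_k$
  does not decrease along the segment, which therefore stays in the same component.
\<close>

lemma average_pair_Gamma_cone: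
  fixes l :: "real ^ 'n"
  assumes k: "2 \<le> k" "k \<le> CARD('n)" and l: "l \<in> Gamma_cone k" and xy: "x \<noteq> y"
  shows "average_pair x y l \<in> Gamma_cone k"
proof -
  obtain j where j: "k = Suc (Suc j)" using k(1) by (metis add_2_eq_Suc le_Suc_ex)
  let ?S = "UNIV - {x, y}"
  define \<gamma> where "\<gamma> s = l + s *\<^sub>R (average_pair x y l - l)" for s :: real
  have comp: "\<gamma> s $ x = l $ x + s * ((l $ y - l $ x) / 2)" "\<gamma> s $ y = l $ y - s * ((l $ y - l $ x) / 2)"
    "i \<in> ?S \<Longrightarrow> \<gamma> s $ i = l $ i" for i s
    by (auto simp: \<gamma>_def average_pair_def field_simps)
  have lpos: "sigma k l > 0" using l connected_component_subset unfolding Gamma_cone_def by blast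
  have pos: "sigma k (\<gamma> s) > 0" if s: "0 \<le> s" "s \<le> 1" for s
  proof -
    have S: "esym ?S m (\<lambda>i. \<gamma> s $ i) = esym ?S m (\<lambda>i. l $ i)" for m
      by (rule esym_cong) (rule comp)
    have "\<gamma> s $ x + \<gamma> s $ y = l $ x + l $ y" by (simp add: comp)
    moreover have "\<gamma> s $ x * \<gamma> s $ y - l $ x * l $ y = ((l $ y - l $ x) / 2)\<^sup>2 * (s * (2 - s))"
      unfolding comp by (simp add: field_simps power2_eq_square)
    moreover have "sigma k (\<gamma> s) - sigma k l =
      ((\<gamma> s $ x + \<gamma> s $ y) - (l $ x + l $ y)) * esym ?S (Suc j) (\<lambda>i. l $ i) +
      (\<gamma> s $ x * \<gamma> s $ y - l $ x * l $ y) * esym ?S j (\<lambda>i. l $ i)"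
      unfolding sigma_eq_esym j esym_two[OF finite UNIV_I UNIV_I xy] S by (simp add: algebra_simps)
    ultimately have "sigma k (\<gamma> s) - sigma k l
        = ((l $ y - l $ x) / 2)\<^sup>2 * (s * (2 - s)) * esym ?S j (\<lambda>i. l $ i)"
by simp
    moreover have "\<dots> \<ge> 0"
      using s esym_two_smaller_nonneg[of j l x y] k l xy j by (intro mult_nonneg_nonneg) auto
    ultimately show ?thesis using lpos by simp
  qed
  have conn: "connected (\<gamma> ` {0..1})"
    unfolding \<gamma>_def by (intro connected_continuous_image continuous_intros) auto
  have sub: "\<gamma> ` {0..1} \<subseteq> {l. sigma k l > 0}" using pos by auto
  have "l \<in> \<gamma> ` {0..1}" by (rule image_eqI[of _ _ 0]) (auto simp: \<gamma>_def)
  moreover have "average_pair x y l \<in> \<gamma> ` {0..1}" by (rule image_eqI[of _ _ 1]) (auto simp: \<gamma>_def)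
  ultimately have "connected_component {l. sigma k l > 0} l (average_pair x y l)"
    unfolding connected_component_def using conn sub by blast
  then show ?thesis
    using l unfolding Gamma_cone_def by (auto intro: connected_component_trans)
qed

lemma average_pair_closure_Gamma_cone:
  fixes l :: "real ^ 'n"
  assumes k: "2 \<le> k" "k \<le> CARD('n)" and l: "l \<in> closure (Gamma_cone k)" and xy: "x \<noteq> y"
  shows "average_pair x y l \<in> closure (Gamma_cone k)"
proof -
  have "continuous_on UNIV (average_pair x y :: real ^ 'n \<Rightarrow> real ^ 'n)"
    unfolding average_pair_def
  proof (intro continuous_on_vec_lambda)
    fix i show "continuous_on UNIV (\<lambda>l::real^'n. if i = x \<or> i = y then (l $ x + l $ y) / 2 else l $ i)"
      by (cases "i = x \<or> i = y") (auto intro!: continuous_intros)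
  qed
  then have "average_pair x y ` closure (Gamma_cone k) \<subseteq> closure (Gamma_cone k :: (real^'n) set)"
    using average_pair_Gamma_cone[OF k _ xy] closure_subset
    by (intro image_closure_subset) (auto intro: continuous_on_subset)
  then show ?thesis using l by blast
qed

text \<open>
  Among the points of $K$ with the given sum over $T$, the given coordinates outside $T$ and
  bounded norm, a point of least norm must be constant on $T$, since averaging two different
  coordinates would decrease the norm.
\<close>

lemma average_mem_closed:
  fixes K :: "(real ^ 'n) set"
  assumes K: "closed K" and avg: "\<And>l x y. l \<in> K \<Longrightarrow> x \<noteq> y \<Longrightarrow> average_pair x y l \<in> K"
    and l: "l \<in> K" and T: "T \<noteq> {}"
  shows "(\<chi> i. if i \<in> T then (\<Sum>j\<in>T. l $ j) / real (card T) else l $ i) \<in> K"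
proof -
  let ?Z = "K \<inter> {m. \<forall>i. i \<notin> T \<longrightarrow> m $ i = l $ i} \<inter> {m. (\<Sum>j\<in>T. m $ j) = (\<Sum>j\<in>T. l $ j)} \<inter> cball 0 (norm l)"
  have "{m. \<forall>i. i \<notin> T \<longrightarrow> m $ i = l $ i} = (\<Inter>i\<in>-T. {m. m $ i = l $ i})" by auto
  then have "closed {m::real^'n. \<forall>i. i \<notin> T \<longrightarrow> m $ i = l $ i}"
    by (auto intro!: closed_INT closed_Collect_eq continuous_intros)
  moreover have "closed {m::real^'n. (\<Sum>j\<in>T. m $ j) = (\<Sum>j\<in>T. l $ j)}"
    by (intro closed_Collect_eq continuous_intros)
  ultimately have "compact ?Z" using K by (intro closed_Int_compact) auto
  moreover have lZ: "l \<in> ?Z" using l by simp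
  ultimately obtain m where m: "m \<in> ?Z" and min: "\<And>m'. m' \<in> ?Z \<Longrightarrow> norm m \<le> norm m'"
    using continuous_attains_inf[of ?Z norm] continuous_on_norm_id by blast
  have eq: "m $ x = m $ y" if xy: "x \<in> T" "y \<in> T" for x y
  proof (rule ccontr)
    assume ne: "m $ x \<noteq> m $ y"
    then have xny: "x \<noteq> y" by auto
    let ?m = "average_pair x y m"
    have split: "sum f A = f x + f y + sum f (A - {x, y})" if "x \<in> A" "y \<in> A" for A and f :: "'n \<Rightarrow> real"
    proof -
      have "sum f A = f x + sum f (A - {x})" using that by (intro sum.remove) auto
      also have "sum f (A - {x}) = f y + sum f (A - {x} - {y})" using that xny by (intro sum.remove) auto
      also have "A - {x} - {y} = A - {x, y}" by auto
      finally show ?thesis by simp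
    qed
    have rest: "sum (\<lambda>i. f (?m $ i)) (A - {x, y}) = sum (\<lambda>i. f (m $ i)) (A - {x, y})" for A and f :: "real \<Rightarrow> real"
      by (intro sum.cong) (auto simp: average_pair_def)
    have mx: "?m $ x = (m $ x + m $ y) / 2" "?m $ y = (m $ x + m $ y) / 2"
      by (auto simp: average_pair_def)
    have "(\<Sum>j\<in>T. ?m $ j) = (\<Sum>j\<in>T. m $ j)"
      using rest[of "\<lambda>z. z" T] by (simp add: split[OF xy] mx)
    moreover have "norm ?m < norm m"
    proof -
      have "(norm m)\<^sup>2 - (norm ?m)\<^sup>2 = (m $ x)\<^sup>2 + (m $ y)\<^sup>2 - 2 * ((m $ x + m $ y) / 2)\<^sup>2"
        unfolding power2_norm_eq_inner inner_vec_def
        using rest[of "\<lambda>z. z * z" UNIV]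
        by (simp add: split[OF UNIV_I UNIV_I] mx power2_eq_square)
      also have "\<dots> = (m $ x - m $ y)\<^sup>2 / 2" by (simp add: field_simps power2_eq_square)
      also have "\<dots> > 0" using ne by simp
      finally show ?thesis by (simp add: power_less_imp_less_base)
    qed
    moreover have "?m $ i = l $ i" if "i \<notin> T" for i
      using that xy m by (auto simp: average_pair_def)
    ultimately have "?m \<in> ?Z" using m avg[OF _ xny] by auto
    then show False using min[of ?m] \<open>norm ?m < norm m\<close> by simp
  qed
  have "m = (\<chi> i. if i \<in> T then (\<Sum>j\<in>T. l $ j) / real (card T) else l $ i)"
  proof (rule vec_eq_iff[THEN iffD2], rule allI)
    fix i
    show "m $ i = (\<chi> i. if i \<in> T then (\<Sum>j\<in>T. l $ j) / real (card T) else l $ i) $ i"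
    proof (cases "i \<in> T")
      case True
      have "(\<Sum>j\<in>T. l $ j) = (\<Sum>j\<in>T. m $ j)" using m by simp
      also have "\<dots> = (\<Sum>j\<in>T. m $ i)" by (intro sum.cong refl eq True)
      finally have "(\<Sum>j\<in>T. l $ j) = real (card T) * m $ i" by simp
      moreover have "card T > 0" using T by (simp add: card_gt_0_iff)
      ultimately show ?thesis using True T by simp
    next
      case False
      then show ?thesis using m by simp
    qed
  qed
  then show ?thesis using m by simp
qed

lemma esym_const: "esym S k (\<lambda>_. b) = of_nat (card S choose k) * b ^ k" if "finite S"
  unfolding esym_def using n_subsets[OF that, of k] by simp

text \<open>
  Averaging all coordinates leads to $(a, \ldots, a)$ with $a$ the mean, and on the line from
  there in direction $(1, \ldots, 1)$ the coefficient of $t^{k-1}$ is a positive multiple of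
  $a$.
\<close>

lemma sum_nonneg_closure_Gamma_cone:
  fixes l :: "real ^ 'n"
  assumes k: "2 \<le> k" "k \<le> CARD('n)" and l: "l \<in> closure (Gamma_cone k)"
  shows "(\<Sum>i\<in>UNIV. l $ i) \<ge> 0"
proof -
  let ?a = "(\<Sum>i\<in>UNIV. l $ i) / real CARD('n)" and ?one = "(\<chi> i. 1) :: real ^ 'n"
  let ?L = "(\<chi> i. ?a) :: real ^ 'n"
  have "?L \<in> closure (Gamma_cone k)"
    using average_mem_closed[OF closed_closure average_pair_closure_Gamma_cone[OF k] l, of UNIV] by simp
  moreover have "closed {l. coeff (line_poly k l ?one) (k - 1) \<ge> 0}"
    by (intro closed_Collect_le continuous_coeff_line_poly continuous_intros)
  then have "closure (Gamma_cone k) \<subseteq> {l. coeff (line_poly k l ?one) (k - 1) \<ge> 0}"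
    using coeff_line_poly_nonneg_Gamma_cone[OF k(2)] by (intro closure_minimal) auto
  ultimately have "coeff (line_poly k ?L ?one) (k - 1) \<ge> 0" by blast
  moreover have "line_poly k ?L ?one = smult (real (CARD('n) choose k)) ([:?a, 1:] ^ k)"
    unfolding line_poly_def by (simp add: esym_const of_nat_poly)
  moreover have "coeff ([:?a, 1:] ^ k) (k - 1) = real k * ?a"
    using coeff_linear_poly_power[of "k - 1" k ?a 1] k binomial_symmetric[of "k - 1" k] by simp
  moreover have "real (CARD('n) choose k) > 0" "real k > 0" using k by simp_all
  ultimately have "?a \<ge> 0" by (simp add: zero_le_mult_iff zero_le_divide_iff)
  then show ?thesis by (simp add: zero_le_divide_iff)
qed

text \<open>
  Averaging all coordinates other than $l_i$ reduces to $(l_i, b, \ldots, b)$, where $\sigma_k$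
  is $b^{k-1}$ times a positive multiple of $l_i + \frac{n-k}{k} b$, and this last factor is
  the asserted combination. The sum of the coordinates being nonnegative forces $b > 0$ if the
  combination is negative, and then $\sigma_k < 0$, which is impossible on $\overline\Gamma_k$.
\<close>

lemma closure_Gamma_cone_linear:
  fixes l :: "real ^ 'n"
  assumes k: "2 \<le> k" "k \<le> CARD('n)" and l: "l \<in> closure (Gamma_cone k)"
    and \<theta>: "\<theta> = (real CARD('n) - real k) / (real k * (real CARD('n) - 1))"
  shows "(1 - \<theta>) * l $ i + \<theta> * (\<Sum>j\<in>UNIV. l $ j) \<ge> 0"
proof (rule ccontr)
  assume neg: "\<not> ?thesis"
  let ?n = "CARD('n)" and ?T = "UNIV - {i}"
  define b where "b = (\<Sum>j\<in>?T. l $ j) / real (?n - 1)"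
  define l' :: "real ^ 'n" where "l' = (\<chi> j. if j \<in> ?T then b else l $ j)"
  have cT: "card ?T = ?n - 1" by simp
  have n1: "real (?n - 1) = real ?n - 1" "real ?n - 1 > 0" using k by auto
  have "?T \<noteq> {}" using cT k by (metis card.empty diff_is_0_eq not_less_eq_eq numeral_2_eq_2 order_trans One_nat_def)
  from average_mem_closed[OF closed_closure average_pair_closure_Gamma_cone[OF k] l this]
  have l': "l' \<in> closure (Gamma_cone k)" unfolding l'_def b_def cT by simp
  have sumT: "(\<Sum>j\<in>?T. l $ j) = (real ?n - 1) * b" using n1 by (simp add: b_def)
  then have sum: "(\<Sum>j\<in>UNIV. l $ j) = l $ i + (real ?n - 1) * b"
    by (simp add: sum.remove[of UNIV i])
  have thn: "\<theta> * (real ?n - 1) = (real ?n - real k) / real k" using n1 k by (simp add: \<theta>)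
  have lin: "l $ i + (real ?n - real k) / real k * b < 0"
    using neg unfolding sum thn[symmetric] by (simp add: algebra_simps)
  have bpos: "b > 0"
  proof (rule ccontr)
    assume "\<not> b > 0"
    moreover have "0 \<le> l $ i + (real ?n - 1) * b"
      using sum_nonneg_closure_Gamma_cone[OF k l] sum by simp
    moreover have "(real ?n - real k) / real k \<le> real ?n - 1"
      using k by (simp add: field_simps)
    ultimately show False using lin mult_right_mono_neg[of "(real ?n - real k) / real k" "real ?n - 1" b] by linarith
  qed
  obtain m where m: "k = Suc m" using k by (cases k) auto
  have "closed {l :: real ^ 'n. sigma k l \<ge> 0}"
    unfolding sigma_def by (intro closed_Collect_le continuous_intros)
  moreover have "Gamma_cone k \<subseteq> {l :: real ^ 'n. sigma k l > 0}"
    unfolding Gamma_cone_def by (rule connected_component_subset)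
  ultimately have "closure (Gamma_cone k) \<subseteq> {l :: real ^ 'n. sigma k l \<ge> 0}"
    by (intro closure_minimal) (auto intro: less_imp_le)
  then have s0: "sigma k l' \<ge> 0" using l' by auto
  have s1: "sigma k l' = real (?n - 1 choose k) * b ^ k + l $ i * (real (?n - 1 choose m) * b ^ m)"
  proof -
    have "esym ?T j (\<lambda>i. l' $ i) = real (?n - 1 choose j) * b ^ j" for j
      using esym_const[of ?T j b] esym_cong[of ?T "\<lambda>i. l' $ i" "\<lambda>_. b" j] by (simp add: l'_def)
    moreover have "l' $ i = l $ i" by (simp add: l'_def)
    ultimately show ?thesis
      unfolding sigma_eq_esym m by (subst esym_remove[of UNIV i]) simp_all
  qed
  have s2: "real (?n - 1 choose k) = (real ?n - real k) / real k * real (?n - 1 choose m)"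
  proof -
    have "Suc m * (?n - 1 choose Suc m) = (?n - 1 - m) * (?n - 1 choose m)"
      by (metis binomial_absorb_comp binomial_absorption mult.commute)
    then have "real k * real (?n - 1 choose k) = real (?n - 1 - m) * real (?n - 1 choose m)"
      unfolding m by (metis of_nat_mult)
    moreover have "real (?n - 1 - m) = real ?n - real k" using m k by simp
    ultimately have "real k * real (?n - 1 choose k) = (real ?n - real k) * real (?n - 1 choose m)"
      by simp
    then show ?thesis using k by (metis mult.commute nonzero_mult_div_cancel_left of_nat_eq_0_iff
        not_numeral_le_zero times_divide_eq_left)
  qed
  have ident: "c * p * (b * q) + x * (p * q) = p * q * (x + c * b)" for c p q x :: real
    by (simp add: algebra_simps)
  have "0 \<le> real (?n - 1 choose m) * b ^ m * (l $ i + (real ?n - real k) / real k * b)"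
    using s0 unfolding s1 s2 ident[symmetric] power_Suc[symmetric] m[symmetric] .
  moreover have "real (?n - 1 choose m) * b ^ m > 0" using bpos m k by simp
  ultimately show False using lin mult_pos_neg not_le by blast
qed

section \<open>Hessians and eigenvalues\<close>

lemma has_derivative_grad:
  fixes f :: "real ^ 'n \<Rightarrow> real"
  assumes "f differentiable (at x)"
  shows "(f has_derivative (\<lambda>h. grad f x \<bullet> h)) (at x)"
proof -
  let ?D = "frechet_derivative f (at x)"
  have D: "(f has_derivative ?D) (at x)" using assms frechet_derivative_works by blast
  then interpret D: linear ?D using has_derivative_linear by blast
  have "?D h = grad f x \<bullet> h" for h
  proof -
    have "?D h = ?D (\<Sum>i\<in>UNIV. h $ i *\<^sub>R axis i 1)"
      using basis_expansion[of h] by (simp add: scalar_mult_eq_scaleR)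
    also have "\<dots> = (\<Sum>i\<in>UNIV. h $ i * ?D (axis i 1))" by (simp add: D.sum D.scaleR)
    also have "\<dots> = grad f x \<bullet> h" by (simp add: grad_def inner_vec_def mult.commute)
    finally show ?thesis .
  qed
  then have "?D = (\<lambda>h. grad f x \<bullet> h)" by auto
  then show ?thesis using D by simp
qed

lemma has_derivative_hessian:
  fixes f :: "real ^ 'n \<Rightarrow> real"
  assumes "grad f differentiable (at x)"
  shows "(grad f has_derivative (\<lambda>h. hessian f x *v h)) (at x)"
  using assms jacobian_works unfolding hessian_def by blast

text \<open>
  The mean value theorem turns the second difference into a difference of first derivatives, which
  the differentiability of the gradient at the single point $x$ controls. The limit is expressed
  asymmetrically in $v$ and $w$ while the quotient is symmetric; this gives the symmetry of the
  Hessian.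
\<close>

lemma second_difference_tendsto:
  fixes f :: "real ^ 'n \<Rightarrow> real"
  assumes S: "open S" "x \<in> S" and f: "\<And>y. y \<in> S \<Longrightarrow> f differentiable (at y)"
    and g: "grad f differentiable (at x)"
  shows "((\<lambda>h. (f (x + h *\<^sub>R v + h *\<^sub>R w) - f (x + h *\<^sub>R v) - f (x + h *\<^sub>R w) + f x) / h\<^sup>2)
    \<longlongrightarrow> v \<bullet> (hessian f x *v w)) (at_right 0)"
proof (rule tendstoI)
  fix \<epsilon> :: real assume \<epsilon>: "\<epsilon> > 0"
  let ?A = "hessian f x" and ?G = "grad f"
  \<comment> \<open>The final error is $\eta (K - 1)$; the summand $1$ keeps $K$ positive when $v = 0$.\<close>
  define K where "K = 2 * (norm v + norm w) * norm v + 1"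
  have K: "K > 0" unfolding K_def by (intro add_nonneg_pos) auto
  define \<eta> where "\<eta> = \<epsilon> / (2 * K)"
  have \<eta>: "\<eta> > 0" using \<epsilon> K by (simp add: \<eta>_def)
  obtain d1 where d1: "d1 > 0" "\<And>y. norm (y - x) < d1 \<Longrightarrow> norm (?G y - ?G x - ?A *v (y - x)) \<le> \<eta> * norm (y - x)"
    using has_derivative_hessian[OF g] \<eta> unfolding has_derivative_at_alt by blast
  obtain d2 where d2: "d2 > 0" "ball x d2 \<subseteq> S" using S open_contains_ball by blast
  define d where "d = min d1 d2 / (norm v + norm w + 1)"
  have nn: "norm v + norm w + 1 > 0" by (intro add_nonneg_pos) auto
  have d: "d > 0" using d1 d2 nn by (simp add: d_def)
  have "\<forall>\<^sub>F h in at_right 0. h < d" using d eventually_at_right_less eventually_at_right by blast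
  then show "\<forall>\<^sub>F h in at_right 0. dist ((f (x + h *\<^sub>R v + h *\<^sub>R w) - f (x + h *\<^sub>R v) - f (x + h *\<^sub>R w) + f x) / h\<^sup>2)
       (v \<bullet> (?A *v w)) < \<epsilon>"
    using eventually_at_right_less[of 0]
  proof eventually_elim
    case (elim h)
    then have h: "0 < h" "h < d" by auto
    have hd: "h * (norm v + norm w + 1) < min d1 d2" using h nn by (simp add: d_def pos_less_divide_eq)
    have bnd: "norm (s *\<^sub>R v + r *\<^sub>R w) \<le> h * (norm v + norm w)" if "0 \<le> s" "s \<le> h" "0 \<le> r" "r \<le> h" for s r
    proof -
      have "norm (s *\<^sub>R v + r *\<^sub>R w) \<le> s * norm v + r * norm w"
        using norm_triangle_ineq[of "s *\<^sub>R v" "r *\<^sub>R w"] that by simp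
      also have "\<dots> \<le> h * norm v + h * norm w" using that by (intro add_mono mult_right_mono) auto
      finally show ?thesis by (simp add: algebra_simps)
    qed
    have bnd': "norm (s *\<^sub>R v + r *\<^sub>R w) < min d1 d2" if "0 \<le> s" "s \<le> h" "0 \<le> r" "r \<le> h" for s r
      using bnd[OF that] hd h by (simp add: algebra_simps)
    have inS: "x + s *\<^sub>R v + r *\<^sub>R w \<in> S" if "0 \<le> s" "s \<le> h" "0 \<le> r" "r \<le> h" for s r
    proof -
      have "dist (x + (s *\<^sub>R v + r *\<^sub>R w)) x < d2"
        using bnd'[OF that] by (simp add: dist_norm)
      then have "x + s *\<^sub>R v + r *\<^sub>R w \<in> ball x d2" by (simp add: dist_commute add.assoc)
      then show ?thesis using d2 by blast
    qed
    have der: "((\<lambda>s. f (x + s *\<^sub>R v + r *\<^sub>R w)) has_real_derivative (?G (x + s *\<^sub>R v + r *\<^sub>R w) \<bullet> v)) (at s)"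
      if "0 \<le> s" "s \<le> h" "0 \<le> r" "r \<le> h" for s r
    proof -
      have "(f has_derivative (\<lambda>k. ?G (x + s *\<^sub>R v + r *\<^sub>R w) \<bullet> k)) (at (x + s *\<^sub>R v + r *\<^sub>R w))"
        by (rule has_derivative_grad[OF f[OF inS[OF that]]])
      moreover have "((\<lambda>s. x + s *\<^sub>R v + r *\<^sub>R w) has_derivative (\<lambda>t. t *\<^sub>R v)) (at s)"
        by (auto intro!: derivative_eq_intros)
      ultimately have "((\<lambda>s. f (x + s *\<^sub>R v + r *\<^sub>R w)) has_derivative (\<lambda>t. ?G (x + s *\<^sub>R v + r *\<^sub>R w) \<bullet> (t *\<^sub>R v))) (at s)"
        using has_derivative_compose by blast
      moreover have "(\<lambda>t. ?G (x + s *\<^sub>R v + r *\<^sub>R w) \<bullet> (t *\<^sub>R v)) = (*) (?G (x + s *\<^sub>R v + r *\<^sub>R w) \<bullet> v)"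
        by (auto simp: mult.commute)
      ultimately show ?thesis unfolding has_field_derivative_def by metis
    qed
    define \<phi> where "\<phi> s = f (x + s *\<^sub>R v + h *\<^sub>R w) - f (x + s *\<^sub>R v + 0 *\<^sub>R w)" for s
    define \<phi>' where "\<phi>' s = ?G (x + s *\<^sub>R v + h *\<^sub>R w) \<bullet> v - ?G (x + s *\<^sub>R v + 0 *\<^sub>R w) \<bullet> v" for s
    have der\<phi>: "(\<phi> has_real_derivative \<phi>' s) (at s)"
      if "0 \<le> s" "s \<le> h" for s
      unfolding \<phi>_def \<phi>'_def using that h by (intro DERIV_diff der) auto
    obtain s where s: "0 < s" "s < h" and mvt: "\<phi> h - \<phi> 0 = (h - 0) * \<phi>' s"
      using MVT2[OF h(1) der\<phi>] by auto
    define R where "R r = ?G (x + s *\<^sub>R v + r *\<^sub>R w) - ?G x - ?A *v (s *\<^sub>R v + r *\<^sub>R w)" for r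
    have R: "norm (R r) \<le> \<eta> * (h * (norm v + norm w))" if "0 \<le> r" "r \<le> h" for r
    proof -
      have "norm (R r) \<le> \<eta> * norm (s *\<^sub>R v + r *\<^sub>R w)"
        using d1(2)[of "x + s *\<^sub>R v + r *\<^sub>R w"] bnd'[of s r] that s unfolding R_def by (simp add: add.assoc)
      also have "\<dots> \<le> \<eta> * (h * (norm v + norm w))"
        using \<eta> bnd[of s r] that s by (intro mult_left_mono) auto
      finally show ?thesis .
    qed
    have "?A *v (s *\<^sub>R v + h *\<^sub>R w) - ?A *v (s *\<^sub>R v + 0 *\<^sub>R w) = h *\<^sub>R (?A *v w)"
      by (simp add: matrix_vector_right_distrib matrix_vector_mult_scaleR)
    then have "?G (x + s *\<^sub>R v + h *\<^sub>R w) - ?G (x + s *\<^sub>R v + 0 *\<^sub>R w) = h *\<^sub>R (?A *v w) + (R h - R 0)"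
      unfolding R_def by (simp add: algebra_simps)
    then have "\<phi> h - \<phi> 0 = h * ((h *\<^sub>R (?A *v w) + (R h - R 0)) \<bullet> v)"
      using mvt by (simp only: \<phi>'_def inner_diff_left[symmetric]) simp
    then have "(\<phi> h - \<phi> 0) / h\<^sup>2 - v \<bullet> (?A *v w) = (R h - R 0) \<bullet> v / h"
      using h by (simp add: divide_simps power2_eq_square inner_add_left inner_commute[of v] distrib_left)
    moreover have "\<bar>(R h - R 0) \<bullet> v\<bar> \<le> (2 * (\<eta> * (h * (norm v + norm w)))) * norm v"
    proof -
      have "norm (R h - R 0) \<le> 2 * (\<eta> * (h * (norm v + norm w)))"
        using norm_triangle_ineq4[of "R h" "R 0"] R[of h] R[of 0] h by simp
      then show ?thesis
        by (intro order_trans[OF Cauchy_Schwarz_ineq2 mult_right_mono]) auto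
    qed
    then have "\<bar>(R h - R 0) \<bullet> v / h\<bar> \<le> \<eta> * (2 * (norm v + norm w) * norm v)"
      using h by (simp add: abs_mult divide_simps mult_ac)
    moreover have "\<eta> * (2 * (norm v + norm w) * norm v) < \<epsilon>"
    proof -
      have "\<eta> * (2 * (norm v + norm w) * norm v) \<le> \<eta> * K" using \<eta> unfolding K_def by (intro mult_left_mono) auto
      also have "\<dots> < \<epsilon>" using \<epsilon> K by (simp add: \<eta>_def)
      finally show ?thesis .
    qed
    moreover have "\<phi> h - \<phi> 0 = f (x + h *\<^sub>R v + h *\<^sub>R w) - f (x + h *\<^sub>R v) - f (x + h *\<^sub>R w) + f x"
      by (simp add: \<phi>_def)
    ultimately show ?case by (simp add: dist_real_def)
  qed
qed

lemma hessian_symmetric: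
  fixes f :: "real ^ 'n \<Rightarrow> real"
  assumes S: "open S" "x \<in> S" and f: "\<And>y. y \<in> S \<Longrightarrow> f differentiable (at y)"
    and g: "grad f differentiable (at x)"
  shows "v \<bullet> (hessian f x *v w) = w \<bullet> (hessian f x *v v)"
proof -
  have "(\<lambda>h. (f (x + h *\<^sub>R v + h *\<^sub>R w) - f (x + h *\<^sub>R v) - f (x + h *\<^sub>R w) + f x) / h\<^sup>2)
      = (\<lambda>h. (f (x + h *\<^sub>R w + h *\<^sub>R v) - f (x + h *\<^sub>R w) - f (x + h *\<^sub>R v) + f x) / h\<^sup>2)"
    by (simp add: add.assoc add.commute algebra_simps)
  from tendsto_unique[OF trivial_limit_at_right_real second_difference_tendsto[OF S f g, of v w, unfolded this]
      second_difference_tendsto[OF S f g, of w v]]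
  show ?thesis .
qed

lemma det_scaleR: "det (c *\<^sub>R (A :: real ^ 'n ^ 'n)) = c ^ CARD('n) * det A"
  by (simp add: det_def prod.distrib sum_distrib_left mult_ac)

text \<open>
  In the Leibniz expansion, a permutation other than the identity moves at least two points, so
  its term vanishes to second order at $s = 0$.
\<close>

lemma has_derivative_det_near_one:
  fixes A :: "real ^ 'n ^ 'n"
  shows "((\<lambda>s. det (mat 1 - s *\<^sub>R A)) has_real_derivative - trace A) (at 0)"
proof -
  let ?P = "{p. p permutes (UNIV :: 'n set)}"
  let ?\<delta> = "\<lambda>p i. (mat 1 :: real ^ 'n ^ 'n) $ i $ p i"
  let ?F = "\<lambda>p s. of_int (sign p) * (\<Prod>i\<in>UNIV. ?\<delta> p i - s * A $ i $ p i)"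
  let ?F' = "\<lambda>p. of_int (sign p) * (\<Sum>i\<in>UNIV. - A $ i $ p i * (\<Prod>j\<in>UNIV - {i}. ?\<delta> p j)) :: real"
  have der: "(?F p has_real_derivative ?F' p) (at 0)" for p
  proof -
    have "((\<lambda>s. \<Prod>i\<in>UNIV. ?\<delta> p i - s * A $ i $ p i) has_real_derivative
        (\<Sum>i\<in>UNIV. - A $ i $ p i * (\<Prod>j\<in>UNIV - {i}. ?\<delta> p j - 0 * A $ j $ p j))) (at 0)"
      by (intro has_field_derivative_prod) (auto intro!: derivative_eq_intros)
    from DERIV_cmult[OF this, of "of_int (sign p)"] show ?thesis by simp
  qed
  have zero: "?F' p = 0" if p: "p \<in> ?P" "p \<noteq> id" for p
  proof -
    obtain a where a: "p a \<noteq> a" using p(2) by fastforce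
    have inj: "inj p" using p(1) permutes_inj by blast
    then have pa: "p (p a) \<noteq> p a" using a injD by fastforce
    have "(\<Prod>j\<in>UNIV - {i}. ?\<delta> p j) = 0" for i
    proof -
      obtain b where b: "b \<in> UNIV - {i}" "p b \<noteq> b"
        using a pa that[of a] that[of "p a"] by (cases "i = a") auto
      then have "?\<delta> p b = 0" by (simp add: mat_def)
      then show ?thesis using b(1) by (intro prod_zero) auto
    qed
    then show ?thesis by (simp only: mult_zero_right sum.neutral_const)
  qed
  have "?F' id = - trace A"
    by (simp add: trace_def mat_def sum_negf)
  then have sum: "(\<Sum>p\<in>?P. ?F' p) = - trace A"
    using zero permutes_id by (subst sum.remove[of _ id]) (auto simp: finite_permutations intro!: sum.neutral)
  have "((\<lambda>s. \<Sum>p\<in>?P. ?F p s) has_real_derivative (\<Sum>p\<in>?P. ?F' p)) (at 0)"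
    by (intro DERIV_sum der)
  then show ?thesis unfolding sum by (simp add: det_def)
qed

lemma trace_eq_sum_eigenvalues:
  fixes A :: "real ^ 'n ^ 'n"
  assumes "is_eigenvalues A l"
  shows "trace A = (\<Sum>i\<in>UNIV. l $ i)"
proof -
  have eq: "det (mat 1 - s *\<^sub>R A) = (\<Prod>i\<in>UNIV. 1 - s * l $ i)" for s
  proof (cases "s = 0")
    case False
    have "mat 1 - s *\<^sub>R A = s *\<^sub>R ((1 / s) *\<^sub>R mat 1 - A)" using False by (simp add: algebra_simps)
    then have "det (mat 1 - s *\<^sub>R A) = s ^ CARD('n) * (\<Prod>i\<in>UNIV. 1 / s - l $ i)"
      using assms by (simp add: det_scaleR is_eigenvalues_def)
    also have "\<dots> = (\<Prod>i\<in>UNIV. s * (1 / s - l $ i))" by (simp add: prod.distrib)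
    also have "\<dots> = (\<Prod>i\<in>UNIV. 1 - s * l $ i)" using False by (simp add: algebra_simps)
    finally show ?thesis .
  qed simp
  have "((\<lambda>s. \<Prod>i\<in>UNIV. 1 - s * l $ i) has_real_derivative
        (\<Sum>i\<in>UNIV. - l $ i * (\<Prod>j\<in>UNIV - {i}. 1 - 0 * l $ j))) (at 0)"
    by (intro has_field_derivative_prod) (auto intro!: derivative_eq_intros)
  then have "((\<lambda>s. det (mat 1 - s *\<^sub>R A)) has_real_derivative - (\<Sum>i\<in>UNIV. l $ i)) (at 0)"
    by (simp add: eq sum_negf)
  then show ?thesis using has_derivative_det_near_one[of A] DERIV_unique by fastforce
qed

text \<open>
  A minimiser of the quadratic form on the unit sphere is an eigenvector.
\<close>

lemma exists_eigenvalue_le: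
  fixes A :: "real ^ 'n ^ 'n"
  assumes sym: "\<And>v w. v \<bullet> (A *v w) = w \<bullet> (A *v v)" and l: "is_eigenvalues A l" and e: "norm e = 1"
  shows "\<exists>i. l $ i \<le> e \<bullet> (A *v e)"
proof -
  have "continuous_on (sphere 0 1) (\<lambda>v. v \<bullet> (A *v v))"
    by (intro continuous_on_inner continuous_on_id matrix_vector_mult_linear_continuous_on)
  moreover have "e \<in> sphere 0 1" using e by simp
  ultimately have "\<exists>v\<in>sphere 0 1. \<forall>w\<in>sphere 0 1. v \<bullet> (A *v v) \<le> w \<bullet> (A *v w)"
    by (intro continuous_attains_inf) auto
  then obtain v where v: "norm v = 1" and min: "\<And>w. norm w = 1 \<Longrightarrow> v \<bullet> (A *v v) \<le> w \<bullet> (A *v w)"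
    by auto
  define m where "m = v \<bullet> (A *v v)"
  have form: "m * (w \<bullet> w) \<le> w \<bullet> (A *v w)" for w
  proof (cases "w = 0")
    case False
    then have "m \<le> ((1 / norm w) *\<^sub>R w) \<bullet> (A *v ((1 / norm w) *\<^sub>R w))"
      unfolding m_def by (intro min) simp
    also have "\<dots> = (w \<bullet> (A *v w)) / (norm w)\<^sup>2"
      by (simp add: matrix_vector_mult_scaleR power2_eq_square)
    finally show ?thesis using False by (simp add: pos_le_divide_eq power2_norm_eq_inner)
  qed simp
  have "w \<bullet> (A *v v - m *\<^sub>R v) = 0" for w
  proof (rule ccontr)
    define b where "b = w \<bullet> (A *v v - m *\<^sub>R v)"
    define c where "c = w \<bullet> (A *v w) - m * (w \<bullet> w)"
    assume "w \<bullet> (A *v v - m *\<^sub>R v) \<noteq> 0"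
    then have b: "b \<noteq> 0" by (simp add: b_def)
    have q: "0 \<le> 2 * t * b + t\<^sup>2 * c" for t
    proof -
      have "0 \<le> (v + t *\<^sub>R w) \<bullet> (A *v (v + t *\<^sub>R w)) - m * ((v + t *\<^sub>R w) \<bullet> (v + t *\<^sub>R w))"
        using form by simp
      also have "\<dots> = 2 * t * b + t\<^sup>2 * c"
        using sym[of v w] v unfolding b_def c_def
        by (simp add: matrix_vector_right_distrib matrix_vector_mult_scaleR inner_simps algebra_simps
          power2_eq_square m_def[symmetric] norm_eq_1 inner_commute[of v w])
      finally show ?thesis .
    qed
    have c0: "0 \<le> c" using form[of w] by (simp add: c_def)
    \<comment> \<open>Near the minimiser $-b/c$ of the quadratic, shifted so that $c = 0$ is allowed.\<close>
    define t where "t = - b / (c + 1)"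
    have "2 * t * b + t\<^sup>2 * c = - (b\<^sup>2) * (c + 2) / (c + 1)\<^sup>2"
      using c0 unfolding t_def by (simp add: divide_simps power2_eq_square) (simp add: algebra_simps)
    moreover have "- (b\<^sup>2) * (c + 2) / (c + 1)\<^sup>2 < 0"
      using b c0 by (intro divide_neg_pos mult_neg_pos) auto
    ultimately show False using q[of t] by simp
  qed
  then have "A *v v - m *\<^sub>R v = 0" by (metis inner_eq_zero_iff)
  then have "(m *\<^sub>R mat 1 - A) *v v = 0"
    by (simp add: matrix_vector_mult_diff_rdistrib scaleR_matrix_vector_assoc[symmetric])
  moreover have "v \<noteq> 0" using v by auto
  ultimately have "det (m *\<^sub>R mat 1 - A) = 0"
    by (metis invertible_det_nz matrix_left_invertible_ker invertible_left_inverse)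
  then have "(\<Prod>i\<in>UNIV. m - l $ i) = 0" using l by (simp add: is_eigenvalues_def)
  then obtain i where "l $ i = m" by auto
  then show ?thesis using min[OF e] unfolding m_def by metis
qed

text \<open>
  The coefficient $1 - \theta$ is nonnegative, so $e^T A e$ may be replaced by an eigenvalue
  below it, and the trace is the sum of the eigenvalues.
\<close>

lemma Gamma_cone_quadratic_form:
  fixes A :: "real ^ 'n ^ 'n"
  assumes k: "2 \<le> k" "k \<le> CARD('n)"
    and sym: "\<And>v w. v \<bullet> (A *v w) = w \<bullet> (A *v v)"
    and l: "is_eigenvalues A l" "l \<in> closure (Gamma_cone k)" and e: "norm e = 1"
    and \<theta>: "\<theta> = (real CARD('n) - real k) / (real k * (real CARD('n) - 1))"
  shows "(1 - \<theta>) * (e \<bullet> (A *v e)) + \<theta> * trace A \<ge> 0"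
proof -
  obtain i where i: "l $ i \<le> e \<bullet> (A *v e)" using exists_eigenvalue_le[OF sym l(1) e] by blast
  have "real CARD('n) * 1 \<le> real CARD('n) * real k" using k by (intro mult_left_mono) auto
  then have "\<theta> \<le> 1" using k unfolding \<theta> by (simp add: divide_simps algebra_simps)
  then have "(1 - \<theta>) * l $ i \<le> (1 - \<theta>) * (e \<bullet> (A *v e))" using i by (intro mult_left_mono) auto
  then show ?thesis
    using closure_Gamma_cone_linear[OF k l(2) \<theta>, of i] trace_eq_sum_eigenvalues[OF l(1)] by simp
qed

section \<open>The barrier\<close>

lemma second_derivative_nonpos_at_max:
  fixes g :: "real \<Rightarrow> real"
  assumes max: "\<forall>\<^sub>F t in at 0. g t \<le> g 0"
    and g: "\<forall>\<^sub>F t in nhds 0. (g has_real_derivative g' t) (at t)"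
    and g': "(g' has_real_derivative c) (at 0)"
  shows "c \<le> 0"
proof (rule ccontr)
  assume "\<not> c \<le> 0"
  then have c: "c > 0" by simp
  obtain d1 where d1: "d1 > 0" "\<And>t. t \<noteq> 0 \<Longrightarrow> \<bar>t\<bar> < d1 \<Longrightarrow> g t \<le> g 0"
    using max by (auto simp: eventually_at dist_real_def)
  obtain d2 where d2: "d2 > 0" "\<And>t. \<bar>t\<bar> < d2 \<Longrightarrow> (g has_real_derivative g' t) (at t)"
    using g by (auto simp: eventually_nhds_metric dist_real_def)
  have "(g has_real_derivative g' 0) (at 0)" using d2 by simp
  moreover have "\<forall>y. \<bar>0 - y\<bar> < d1 \<longrightarrow> g y \<le> g 0" using d1(2) by (metis abs_minus_commute diff_zero order_refl)
  ultimately have "g' 0 = 0" using DERIV_local_max[of g "g' 0" 0 d1] d1(1) by blast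
  obtain d3 where d3: "d3 > 0" "\<And>h. 0 < h \<Longrightarrow> h < d3 \<Longrightarrow> g' 0 < g' (0 + h)"
    using DERIV_pos_inc_right[OF g' c] by blast
  define b where "b = min d1 (min d2 d3) / 2"
  have b: "0 < b" "b < d1" "b < d2" "b < d3" using d1 d2 d3 by (auto simp: b_def)
  have "\<And>t. 0 \<le> t \<Longrightarrow> t \<le> b \<Longrightarrow> (g has_real_derivative g' t) (at t)" using d2(2) b by auto
  from MVT2[OF b(1) this] obtain s where s: "0 < s" "s < b" "g b - g 0 = (b - 0) * g' s" by auto
  then have "g' s > 0" using d3(2)[of s] \<open>g' 0 = 0\<close> b by simp
  then have "g b > g 0" using s b by (simp add: algebra_simps)
  then show False using d1(2)[of b] b by simp
qed

text \<open>
  First and second derivative of $q^a (1 + \frac{\delta}{2} (\ln q - \ln z))$ along a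
  line. The second derivative is left unsimplified so that each summand can be summed over an
  orthonormal basis.
\<close>

lemma barrier_profile_derivatives:
  fixes q z q' z' :: "real \<Rightarrow> real" and a \<delta> :: real
  assumes q: "\<And>t. (q has_real_derivative q' t) (at t)" "(q' has_real_derivative q'') (at 0)" "q 0 > 0"
    and z: "\<And>t. (z has_real_derivative z' t) (at t)" "(z' has_real_derivative z'') (at 0)" "z 0 > 0"
  defines "F \<equiv> \<lambda>t. q t powr a * (1 + \<delta> / 2 * (ln (q t) - ln (z t)))"
    and "F' \<equiv> \<lambda>t. q t powr a * (a * (q' t / q t) * (1 + \<delta> / 2 * (ln (q t) - ln (z t)))
              + \<delta> / 2 * (q' t / q t - z' t / z t))"
  shows "\<forall>\<^sub>F t in nhds 0. (F has_real_derivative F' t) (at t)"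
    and "(F' has_real_derivative q 0 powr a *
        (a\<^sup>2 * (q' 0)\<^sup>2 / (q 0)\<^sup>2 * (1 + \<delta> / 2 * (ln (q 0) - ln (z 0)))
         + a * \<delta> * ((q' 0)\<^sup>2 / (q 0)\<^sup>2 - q' 0 * z' 0 / (q 0 * z 0))
         + a * (1 + \<delta> / 2 * (ln (q 0) - ln (z 0))) * (q'' / q 0 - (q' 0)\<^sup>2 / (q 0)\<^sup>2)
         + \<delta> / 2 * (q'' / q 0 - (q' 0)\<^sup>2 / (q 0)\<^sup>2 - z'' / z 0 + (z' 0)\<^sup>2 / (z 0)\<^sup>2))) (at 0)"
proof -
  have lnd: "((\<lambda>t. 1 + \<delta> / 2 * (ln (q t) - ln (z t))) has_real_derivative \<delta> / 2 * (q' t / q t - z' t / z t)) (at t)"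
    if "q t > 0" "z t > 0" for t
    using that by (auto intro!: derivative_eq_intros q(1) z(1) simp: field_simps)
  have pow: "((\<lambda>t. q t powr a) has_real_derivative q t powr a * (a * (q' t / q t))) (at t)" if "q t > 0" for t
  proof -
    have "((\<lambda>t. q t powr a) has_real_derivative a * q t powr (a - 1) * q' t) (at t)"
      using has_real_derivative_powr[OF that, of a] DERIV_chain2[OF _ q(1)] by blast
    moreover have "a * q t powr (a - 1) * q' t = q t powr a * (a * (q' t / q t))"
      using that by (simp add: powr_diff)
    ultimately show ?thesis by simp
  qed
  have "isCont q 0" "isCont z 0" using q(1) z(1) DERIV_isCont by blast+
  then have "\<forall>\<^sub>F t in at 0. q t > 0" "\<forall>\<^sub>F t in at 0. z t > 0"
    using q(3) z(3) order_tendstoD(1) unfolding isCont_def by blast+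
  then have "\<forall>\<^sub>F t in nhds 0. q t > 0" "\<forall>\<^sub>F t in nhds 0. z t > 0"
    using q(3) z(3) by (auto simp: eventually_nhds_conv_at)
  then show "\<forall>\<^sub>F t in nhds 0. (F has_real_derivative F' t) (at t)"
  proof eventually_elim
    case (elim t)
    show ?case unfolding F_def F'_def
      by (rule DERIV_cong[OF DERIV_mult[OF pow[OF elim(1)] lnd[OF elim]]]) (simp add: distrib_left mult_ac)
  qed
  have rq: "((\<lambda>t. q' t / q t) has_real_derivative (q'' / q 0 - (q' 0)\<^sup>2 / (q 0)\<^sup>2)) (at 0)"
    using DERIV_divide[OF q(2) q(1)] q(3) by (simp add: power2_eq_square diff_divide_distrib)
  have rz: "((\<lambda>t. z' t / z t) has_real_derivative (z'' / z 0 - (z' 0)\<^sup>2 / (z 0)\<^sup>2)) (at 0)"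
    using DERIV_divide[OF z(2) z(1)] z(3) by (simp add: power2_eq_square diff_divide_distrib)
  define \<Psi> where "\<Psi> = 1 + \<delta> / 2 * (ln (q 0) - ln (z 0))"
  define A B Q Z where "A = q' 0 / q 0" and "B = z' 0 / z 0"
    and "Q = q'' / q 0 - (q' 0)\<^sup>2 / (q 0)\<^sup>2" and "Z = z'' / z 0 - (z' 0)\<^sup>2 / (z 0)\<^sup>2"
  have "(F' has_real_derivative (q 0 powr a * (a * A)) * (a * A * \<Psi> + \<delta> / 2 * (A - B))
      + ((a * Q) * \<Psi> + (\<delta> / 2 * (A - B)) * (a * A) + \<delta> / 2 * (Q - Z)) * q 0 powr a) (at 0)"
    unfolding F'_def \<Psi>_def A_def B_def Q_def Z_def
    by (intro DERIV_mult DERIV_add DERIV_cmult DERIV_diff pow lnd rq rz q(3) z(3))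
  moreover have "(q 0 powr a * (a * A)) * (a * A * \<Psi> + \<delta> / 2 * (A - B))
      + ((a * Q) * \<Psi> + (\<delta> / 2 * (A - B)) * (a * A) + \<delta> / 2 * (Q - Z)) * q 0 powr a
    = q 0 powr a * (a\<^sup>2 * A\<^sup>2 * \<Psi> + a * \<delta> * (A\<^sup>2 - A * B) + a * \<Psi> * Q + \<delta> / 2 * (Q - Z))"
    by (simp add: field_simps power2_eq_square)
  moreover have minus_diff: "x - (y - w) = x - y + w" for x y w :: real by simp
  ultimately show "(F' has_real_derivative q 0 powr a *
        (a\<^sup>2 * (q' 0)\<^sup>2 / (q 0)\<^sup>2 * (1 + \<delta> / 2 * (ln (q 0) - ln (z 0)))
         + a * \<delta> * ((q' 0)\<^sup>2 / (q 0)\<^sup>2 - q' 0 * z' 0 / (q 0 * z 0))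
         + a * (1 + \<delta> / 2 * (ln (q 0) - ln (z 0))) * (q'' / q 0 - (q' 0)\<^sup>2 / (q 0)\<^sup>2)
         + \<delta> / 2 * (q'' / q 0 - (q' 0)\<^sup>2 / (q 0)\<^sup>2 - z'' / z 0 + (z' 0)\<^sup>2 / (z 0)\<^sup>2))) (at 0)"
    by (simp add: A_def B_def Q_def Z_def \<Psi>_def power_divide minus_diff)
qed

text \<open>
  For a unit vector $e$, the squared distance of $w$ to the line spanned by $e$.
\<close>

definition dist2_line :: "'a::real_inner \<Rightarrow> 'a \<Rightarrow> real" where
  "dist2_line e w = w \<bullet> w - (w \<bullet> e)\<^sup>2"

text \<open>
  The power $|w|^{2a}$, perturbed by $\delta\, |w|^{2a} \ln(|w| / d)$ with $d$ the distance of
  $w$ to the line spanned by $e$. The perturbation is nonnegative and tends to infinity at the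
  points of the line other than the origin.
\<close>

definition barrier :: "real \<Rightarrow> real \<Rightarrow> 'a::real_inner \<Rightarrow> 'a \<Rightarrow> real" where
  "barrier a \<delta> e w = (w \<bullet> w) powr a * (1 + \<delta> / 2 * (ln (w \<bullet> w) - ln (dist2_line e w)))"

text \<open>
  The Hessian of \<open>barrier a \<delta> e\<close> at $w$ as a quadratic form in $v$; the primed
  quantities are the derivatives of $q$ and $z$ along the line $w + t v$ at $t = 0$.
\<close>

definition barrier_hessian :: "real \<Rightarrow> real \<Rightarrow> 'a::real_inner \<Rightarrow> 'a \<Rightarrow> 'a \<Rightarrow> real" where
  "barrier_hessian a \<delta> e w v = (let q = w \<bullet> w; z = dist2_line e w; \<Psi> = 1 + \<delta> / 2 * (ln q - ln z);
      q' = 2 * (w \<bullet> v); z' = 2 * (w \<bullet> v - (w \<bullet> e) * (v \<bullet> e));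
      q'' = 2 * (v \<bullet> v); z'' = 2 * (v \<bullet> v - (v \<bullet> e)\<^sup>2)
    in q powr a * (a\<^sup>2 * q'\<^sup>2 / q\<^sup>2 * \<Psi> + a * \<delta> * (q'\<^sup>2 / q\<^sup>2 - q' * z' / (q * z))
       + a * \<Psi> * (q'' / q - q'\<^sup>2 / q\<^sup>2) + \<delta> / 2 * (q'' / q - q'\<^sup>2 / q\<^sup>2 - z'' / z + z'\<^sup>2 / z\<^sup>2)))"

lemma barrier_line_derivatives:
  fixes w e v :: "'a::real_inner"
  assumes z: "dist2_line e w > 0"
  obtains g' where "\<forall>\<^sub>F t in nhds 0. ((\<lambda>t. barrier a \<delta> e (w + t *\<^sub>R v)) has_real_derivative g' t) (at t)"
    and "(g' has_real_derivative barrier_hessian a \<delta> e w v) (at 0)"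
proof -
  define q where "q t = (w + t *\<^sub>R v) \<bullet> (w + t *\<^sub>R v)" for t
  define z where "z t = dist2_line e (w + t *\<^sub>R v)" for t
  define q' where "q' t = 2 * (w \<bullet> v) + 2 * t * (v \<bullet> v)" for t
  define z' where "z' t = q' t - 2 * ((w + t *\<^sub>R v) \<bullet> e) * (v \<bullet> e)" for t
  have q_eq: "q = (\<lambda>t. w \<bullet> w + 2 * t * (w \<bullet> v) + t\<^sup>2 * (v \<bullet> v))"
    unfolding q_def by (rule ext)
      (simp add: inner_add_left inner_add_right inner_commute[of v w] power2_eq_square distrib_left)
  have dq: "(q has_real_derivative q' t) (at t)" for t
    unfolding q_eq q'_def by (auto intro!: derivative_eq_intros)
  have dq': "(q' has_real_derivative 2 * (v \<bullet> v)) (at 0)"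
    unfolding q'_def by (auto intro!: derivative_eq_intros)
  have z_eq: "z = (\<lambda>t. q t - (w \<bullet> e + t * (v \<bullet> e))\<^sup>2)"
    by (auto simp: z_def q_def dist2_line_def inner_add_left)
  have dz: "(z has_real_derivative z' t) (at t)" for t
    unfolding z_eq z'_def by (auto intro!: derivative_eq_intros dq simp: inner_add_left)
  have z'_eq: "z' = (\<lambda>t. q' t - 2 * (w \<bullet> e + t * (v \<bullet> e)) * (v \<bullet> e))"
    by (auto simp: z'_def inner_add_left)
  have dz': "(z' has_real_derivative 2 * (v \<bullet> v - (v \<bullet> e)\<^sup>2)) (at 0)"
    unfolding z'_eq by (auto intro!: derivative_eq_intros dq' simp: power2_eq_square)
  have z0: "z 0 = dist2_line e w" "q 0 = w \<bullet> w" "q' 0 = 2 * (w \<bullet> v)"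
    "z' 0 = 2 * (w \<bullet> v - (w \<bullet> e) * (v \<bullet> e))"
    by (simp_all add: z_def q_def q'_def z'_def)
  have "w \<bullet> w > 0" using assms by (auto simp: dist2_line_def)
  then have pos: "q 0 > 0" "z 0 > 0" using assms z0 by auto
  from barrier_profile_derivatives[OF dq dq' pos(1) dz dz' pos(2), of a \<delta>]
  show ?thesis
    by (intro that) (simp_all add: barrier_def barrier_hessian_def Let_def z0 flip: q_def z_def)
qed

lemma dist2_line_nonneg:
  fixes w :: "'a::real_inner"
  assumes "norm e = 1"
  shows "dist2_line e w \<ge> 0"
  using Cauchy_Schwarz_ineq[of w e] assms by (simp add: dist2_line_def norm_eq_1)

text \<open>
  The logarithmic factor is homogeneous of degree $0$, so only the power is differentiated.
\<close>

lemma barrier_hessian_radial: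
  fixes w :: "'a::real_inner"
  assumes z: "dist2_line e w > 0"
  shows "barrier_hessian a \<delta> e w ((1 / norm w) *\<^sub>R w) =
    (w \<bullet> w) powr a / (w \<bullet> w) * (2 * a * (2 * a - 1) * (1 + \<delta> / 2 * (ln (w \<bullet> w) - ln (dist2_line e w))))"
proof -
  define q z \<Psi> r s where "q = w \<bullet> w" and "z = dist2_line e w" and "\<Psi> = 1 + \<delta> / 2 * (ln q - ln z)"
    and "r = norm w" and "s = w \<bullet> e"
  have w: "w \<noteq> 0" using assms by (auto simp: dist2_line_def)
  have r: "r > 0" "q = r\<^sup>2" using w by (auto simp: r_def q_def power2_norm_eq_inner)
  have qp: "q > 0" using r by simp
  have zp: "z > 0" using assms by (simp add: z_def)
  have zs: "z = r\<^sup>2 - s\<^sup>2" by (simp add: z_def dist2_line_def s_def r_def power2_norm_eq_inner)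
  define v where "v = (1 / norm w) *\<^sub>R w"
  have v: "w \<bullet> v = r" "v \<bullet> v = 1" "v \<bullet> e = s / r"
    using w r by (auto simp: v_def s_def r_def dot_square_norm power2_eq_square)
  have a1: "(2 * r)\<^sup>2 / q\<^sup>2 = 4 / q" using r by (simp add: power2_eq_square)
  have a2: "2 * (r - s * (s / r)) = 2 * z / r" using r zs by (simp add: field_simps power2_eq_square)
  have a3: "2 * r * (2 * z / r) / (q * z) = 4 / q" using r zp by simp
  have a4: "2 * (1 - (s / r)\<^sup>2) / z = 2 / q"
  proof -
    have "1 - (s / r)\<^sup>2 = z / r\<^sup>2" using r zs by (simp add: field_simps power_divide)
    then show ?thesis using zp r by simp
  qed
  have a5: "(2 * z / r)\<^sup>2 / z\<^sup>2 = 4 / q" using r zp by (simp add: power_divide power_mult_distrib)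
  have a6: "a\<^sup>2 * (2 * r)\<^sup>2 / q\<^sup>2 = a\<^sup>2 * (4 / q)" by (simp only: times_divide_eq_right[symmetric] a1)
  show ?thesis
    unfolding barrier_hessian_def Let_def v_def[symmetric] v q_def[symmetric] z_def[symmetric] s_def[symmetric] a2
      a1 a3 a4 a5 a6 \<Psi>_def[symmetric]
    using qp by (simp add: divide_simps power2_eq_square) (simp add: algebra_simps)
qed

text \<open>
  The gradients of $\ln q$ and $\ln z$ have the same inner product with that of $q$, so the
  mixed terms cancel in the trace.
\<close>

lemma barrier_laplacian:
  fixes w e :: "real ^ 'n"
  assumes z: "dist2_line e w > 0" and e: "norm e = 1"
  shows "(\<Sum>i\<in>UNIV. barrier_hessian a \<delta> e w (axis i 1)) =
    (w \<bullet> w) powr a / (w \<bullet> w) *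
     (2 * a * (2 * a + real CARD('n) - 2) * (1 + \<delta> / 2 * (ln (w \<bullet> w) - ln (dist2_line e w)))
      + \<delta> * ((real CARD('n) - 2) - (real CARD('n) - 3) * (w \<bullet> w) / dist2_line e w))"
proof -
  define q z \<Psi> s n where "q = w \<bullet> w" and "z = dist2_line e w" and "\<Psi> = 1 + \<delta> / 2 * (ln q - ln z)"
    and "s = w \<bullet> e" and "n = real CARD('n)"
  have zp: "z > 0" using assms by (simp add: z_def)
  have zs: "z = q - s\<^sup>2" by (simp add: z_def q_def dist2_line_def s_def)
  have qp: "q > 0" using zp zs by (smt (verit) zero_le_power2)
  have ee: "e \<bullet> e = 1" using e by (simp add: norm_eq_1)
  define p where "p i = 2 * (w $ i)" for i
  define y where "y i = 2 * (w $ i - s * e $ i)" for i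
  define y2 where "y2 i = 2 * (1 - (e $ i)\<^sup>2)" for i
  have sq: "(\<Sum>i\<in>UNIV. w $ i * w $ i) = q" by (simp add: q_def inner_vec_def)
  have se: "(\<Sum>i\<in>UNIV. w $ i * e $ i) = s" by (simp add: s_def inner_vec_def)
  have s1: "(\<Sum>i\<in>UNIV. e $ i * e $ i) = 1" using ee by (simp add: inner_vec_def)
  have p2: "(\<Sum>i\<in>UNIV. (p i)\<^sup>2) = 4 * q"
    by (simp add: p_def power2_eq_square sq[symmetric] sum_distrib_left)
  have "(\<Sum>i\<in>UNIV. p i * y i) = (\<Sum>i\<in>UNIV. 4 * (w $ i * w $ i) - 4 * s * (w $ i * e $ i))"
    by (intro sum.cong) (auto simp: p_def y_def algebra_simps)
  then have py: "(\<Sum>i\<in>UNIV. p i * y i) = 4 * z"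
    by (simp add: sum_subtractf sum_distrib_left[symmetric] sq se zs power2_eq_square)
  have "(\<Sum>i\<in>UNIV. (y i)\<^sup>2) = (\<Sum>i\<in>UNIV. 4 * (w $ i * w $ i) - 8 * s * (w $ i * e $ i) + 4 * s\<^sup>2 * (e $ i * e $ i))"
    by (intro sum.cong) (auto simp: y_def algebra_simps power2_eq_square)
  then have yy: "(\<Sum>i\<in>UNIV. (y i)\<^sup>2) = 4 * z"
    by (simp add: sum.distrib sum_subtractf sum_distrib_left[symmetric] sq se s1 zs power2_eq_square)
  have yy2: "(\<Sum>i\<in>UNIV. y2 i) = 2 * (n - 1)"
    by (simp add: y2_def sum_subtractf sum_distrib_left[symmetric] power2_eq_square s1 n_def)
  have "barrier_hessian a \<delta> e w (axis i 1) = q powr a * ((a\<^sup>2 * \<Psi> + a * \<delta> - a * \<Psi> - \<delta> / 2) / q\<^sup>2 * (p i)\<^sup>2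
     + (- (a * \<delta> / (q * z))) * (p i * y i) + (a * \<Psi> + \<delta> / 2) / q * 2 + (- (\<delta> / (2 * z))) * y2 i
     + \<delta> / (2 * z\<^sup>2) * (y i)\<^sup>2)" for i
  proof -
    have ax: "w \<bullet> axis i 1 = w $ i" "axis i 1 \<bullet> e = e $ i" "axis i 1 \<bullet> (axis i 1 :: real ^ 'n) = 1"
      by (simp_all add: inner_axis inner_axis')
    have r: "2 * (1::real) = 2" by simp
    show ?thesis
      unfolding barrier_hessian_def Let_def ax q_def[symmetric] z_def[symmetric] s_def[symmetric]
        \<Psi>_def[symmetric] p_def[symmetric] y_def[symmetric] y2_def[symmetric] r
      using qp zp by (simp add: field_simps)
  qed
  then have "(\<Sum>i\<in>UNIV. barrier_hessian a \<delta> e w (axis i 1)) =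
     q powr a * ((a\<^sup>2 * \<Psi> + a * \<delta> - a * \<Psi> - \<delta> / 2) / q\<^sup>2 * (4 * q)
     + (- (a * \<delta> / (q * z))) * (4 * z) + (a * \<Psi> + \<delta> / 2) / q * 2 * n + (- (\<delta> / (2 * z))) * (2 * (n - 1))
     + \<delta> / (2 * z\<^sup>2) * (4 * z))"
    by (simp only: sum_distrib_left[symmetric] sum.distrib p2 py yy yy2) (simp add: n_def mult_ac)
  also have "\<dots> = q powr a / q * (2 * a * (2 * a + n - 2) * \<Psi> + \<delta> * ((n - 2) - (n - 3) * q / z))"
    using qp zp by (simp add: field_simps power2_eq_square)
  finally show ?thesis unfolding q_def z_def \<Psi>_def n_def .
qed

text \<open>
  The power alone contributes $-2a(\alpha - 2a)$, up to a positive factor, because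
  $(1-\theta)(2a-1) + \theta(2a+n-2) = 2a - \alpha$. The logarithm contributes
  $\theta\delta((n-2) - (n-3)\, q/z)$. As $q \ge z$, this is at most $\theta\delta$ when
  $n \ge 3$; in the plane it would be unbounded, and $\theta$ has to vanish, as it does for
  $k = n = 2$.
\<close>

lemma barrier_strict_supersolution:
  fixes w e :: "real ^ 'n"
  assumes e: "norm e = 1" and z: "dist2_line e w > 0"
    and \<theta>: "0 \<le> \<theta>" "\<theta> = 0 \<or> CARD('n) \<ge> 3" and \<delta>: "\<delta> > 0"
    and a: "0 < a" "2 * a < \<alpha>" and \<alpha>: "\<alpha> = 1 - (real CARD('n) - 1) * \<theta>"
    and small: "\<theta> * \<delta> < 2 * a * (\<alpha> - 2 * a)"
  shows "(1 - \<theta>) * barrier_hessian a \<delta> e w ((1 / norm w) *\<^sub>R w)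
    + \<theta> * (\<Sum>i\<in>UNIV. barrier_hessian a \<delta> e w (axis i 1)) < 0"
proof -
  define q z \<Psi> n where "q = w \<bullet> w" and "z = dist2_line e w" and "\<Psi> = 1 + \<delta> / 2 * (ln q - ln z)"
    and "n = real CARD('n)"
  have zp: "z > 0" using assms by (simp add: z_def)
  have qz: "z \<le> q" by (simp add: z_def q_def dist2_line_def)
  then have qp: "q > 0" using zp by simp
  have "ln z \<le> ln q" using qz zp by simp
  then have \<Psi>: "\<Psi> \<ge> 1" using \<delta> by (simp add: \<Psi>_def)
  define D where "D = (n - 2) - (n - 3) * q / z"
  have D: "\<theta> * D \<le> \<theta>"
  proof (cases "\<theta> = 0")
    case False
    then have "n \<ge> 3" using \<theta> by (simp add: n_def)
    moreover have "q / z \<ge> 1" using qz zp by simp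
    ultimately have "(n - 3) * (q / z) \<ge> (n - 3) * 1" by (intro mult_left_mono) auto
    then have "D \<le> 1" by (simp add: D_def)
    then show ?thesis using \<theta>(1) mult_left_mono[of D 1 \<theta>] by simp
  qed simp
  have "2 * a * (\<alpha> - 2 * a) * 1 \<le> 2 * a * (\<alpha> - 2 * a) * \<Psi>" using a \<Psi> by (intro mult_left_mono) auto
  moreover have "\<delta> * (\<theta> * D) \<le> \<delta> * \<theta>" using D \<delta> by (intro mult_left_mono) auto
  ultimately have neg: "- (2 * a * (\<alpha> - 2 * a) * \<Psi>) + \<delta> * (\<theta> * D) < 0"
    using small by (simp add: mult.commute)
  have "(1 - \<theta>) * barrier_hessian a \<delta> e w ((1 / norm w) *\<^sub>R w)
    + \<theta> * (\<Sum>i\<in>UNIV. barrier_hessian a \<delta> e w (axis i 1))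
    = q powr a / q * ((1 - \<theta>) * (2 * a * (2 * a - 1) * \<Psi>) + \<theta> * (2 * a * (2 * a + n - 2) * \<Psi> + \<delta> * D))"
    unfolding barrier_hessian_radial[OF z] barrier_laplacian[OF z e] D_def
      q_def[symmetric] z_def[symmetric] \<Psi>_def[symmetric] n_def[symmetric]
    by (simp only: ring_distribs mult_ac)
  also have "(1 - \<theta>) * (2 * a * (2 * a - 1) * \<Psi>) + \<theta> * (2 * a * (2 * a + n - 2) * \<Psi> + \<delta> * D)
    = - (2 * a * (\<alpha> - 2 * a) * \<Psi>) + \<delta> * (\<theta> * D)"
    unfolding \<alpha> n_def[symmetric] by (simp add: algebra_simps)
  also have "q powr a / q * \<dots> < 0" using neg qp by (intro mult_pos_neg) auto
  finally show ?thesis .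
qed

lemma has_derivative_along_line:
  fixes u :: "real ^ 'n \<Rightarrow> real"
  assumes S: "open S" "x \<in> S" and u: "\<And>y. y \<in> S \<Longrightarrow> u differentiable (at y)"
    and g: "grad u differentiable (at x)"
  shows "\<forall>\<^sub>F t in nhds 0. ((\<lambda>t. u (x + t *\<^sub>R v)) has_real_derivative grad u (x + t *\<^sub>R v) \<bullet> v) (at t)"
    and "((\<lambda>t. grad u (x + t *\<^sub>R v) \<bullet> v) has_real_derivative v \<bullet> (hessian u x *v v)) (at 0)"
proof -
  have line: "((\<lambda>t. x + t *\<^sub>R v) has_derivative (\<lambda>t. t *\<^sub>R v)) (at s)" for s
    by (auto intro!: derivative_eq_intros)
  have "isCont (\<lambda>t. x + t *\<^sub>R v) 0" by (intro continuous_intros)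
  then have "((\<lambda>t. x + t *\<^sub>R v) \<longlongrightarrow> x) (nhds 0)"
    by (simp add: isCont_def tendsto_nhds_iff)
  then have "\<forall>\<^sub>F t in nhds 0. x + t *\<^sub>R v \<in> S" using topological_tendstoD S by blast
  then show "\<forall>\<^sub>F t in nhds 0. ((\<lambda>t. u (x + t *\<^sub>R v)) has_real_derivative grad u (x + t *\<^sub>R v) \<bullet> v) (at t)"
  proof eventually_elim
    case (elim t)
    have "((\<lambda>t. u (x + t *\<^sub>R v)) has_derivative (\<lambda>s. grad u (x + t *\<^sub>R v) \<bullet> (s *\<^sub>R v))) (at t)"
      by (rule has_derivative_compose[OF line has_derivative_grad[OF u[OF elim]]])
    moreover have "(\<lambda>s. grad u (x + t *\<^sub>R v) \<bullet> (s *\<^sub>R v)) = (*) (grad u (x + t *\<^sub>R v) \<bullet> v)"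
      by (auto simp: mult.commute)
    ultimately show ?case unfolding has_field_derivative_def by metis
  qed
  have "(grad u has_derivative (\<lambda>h. hessian u x *v h)) (at (x + 0 *\<^sub>R v))"
    using has_derivative_hessian[OF g] by simp
  then have "((\<lambda>t. grad u (x + t *\<^sub>R v)) has_derivative (\<lambda>t. hessian u x *v (t *\<^sub>R v))) (at 0)"
    by (rule has_derivative_compose[OF line])
  then have "((\<lambda>t. grad u (x + t *\<^sub>R v) \<bullet> v) has_derivative (\<lambda>t. (hessian u x *v (t *\<^sub>R v)) \<bullet> v)) (at 0)"
    by (rule has_derivative_inner_left)
  moreover have "(\<lambda>t. (hessian u x *v (t *\<^sub>R v)) \<bullet> v) = (*) (v \<bullet> (hessian u x *v v))"
    by (auto simp: matrix_vector_mult_scaleR inner_commute mult.commute)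
  ultimately show "((\<lambda>t. grad u (x + t *\<^sub>R v) \<bullet> v) has_real_derivative v \<bullet> (hessian u x *v v)) (at 0)"
    unfolding has_field_derivative_def by metis
qed

lemma hessian_le_barrier_hessian_at_max:
  fixes u :: "real ^ 'n \<Rightarrow> real"
  assumes S: "open S" "x \<in> S" and u: "\<And>y. y \<in> S \<Longrightarrow> u differentiable (at y)"
    and g: "grad u differentiable (at x)" and z: "dist2_line e (x - y) > 0"
    and max: "\<forall>\<^sub>F x' in nhds x. u x' - c * barrier a \<delta> e (x' - y) \<le> u x - c * barrier a \<delta> e (x - y)"
  shows "v \<bullet> (hessian u x *v v) \<le> c * barrier_hessian a \<delta> e (x - y) v"
proof -
  obtain b' where b: "\<forall>\<^sub>F t in nhds 0. ((\<lambda>t. barrier a \<delta> e (x - y + t *\<^sub>R v)) has_real_derivative b' t) (at t)"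
    and b': "(b' has_real_derivative barrier_hessian a \<delta> e (x - y) v) (at 0)"
    using barrier_line_derivatives[OF z, of a \<delta> v] by blast
  define h where "h t = u (x + t *\<^sub>R v) - c * barrier a \<delta> e (x - y + t *\<^sub>R v)" for t
  define h' where "h' t = grad u (x + t *\<^sub>R v) \<bullet> v - c * b' t" for t
  have "\<forall>\<^sub>F t in nhds 0. ((\<lambda>t. u (x + t *\<^sub>R v)) has_real_derivative grad u (x + t *\<^sub>R v) \<bullet> v) (at t)"
    by (rule has_derivative_along_line(1)[OF S _ g]) (rule u)
  then have 1: "\<forall>\<^sub>F t in nhds 0. (h has_real_derivative h' t) (at t)"
    using b
    unfolding h_def[abs_def] h'_def by eventually_elim (intro DERIV_diff DERIV_cmult)
  have 2: "(h' has_real_derivative (v \<bullet> (hessian u x *v v) - c * barrier_hessian a \<delta> e (x - y) v)) (at 0)"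
    unfolding h'_def by (intro DERIV_diff DERIV_cmult has_derivative_along_line(2)[OF S _ g] b' u)
  have "isCont (\<lambda>t. x + t *\<^sub>R v) 0" by (intro continuous_intros)
  then have "filterlim (\<lambda>t. x + t *\<^sub>R v) (nhds x) (at 0)" by (simp add: isCont_def)
  from eventually_compose_filterlim[OF max this]
  have "\<forall>\<^sub>F t in at 0. h t \<le> h 0" by (simp add: h_def algebra_simps)
  from second_derivative_nonpos_at_max[OF this 1 2] show ?thesis by simp
qed

section \<open>Comparison\<close>

lemma trace_eq_sum_quadratic_form: "trace (A :: real ^ 'n ^ 'n) = (\<Sum>i\<in>UNIV. axis i 1 \<bullet> (A *v axis i 1))"
  unfolding trace_def by (intro sum.cong refl) (simp add: inner_axis' matrix_vector_mult_basis column_def)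

lemma barrier_ge_powr:
  assumes "norm e = 1" "dist2_line e w > 0" "\<delta> \<ge> 0"
  shows "barrier a \<delta> e w \<ge> (w \<bullet> w) powr a"
proof -
  have "dist2_line e w \<le> w \<bullet> w" by (simp add: dist2_line_def)
  then have "ln (dist2_line e w) \<le> ln (w \<bullet> w)"
    using assms(2) by (intro ln_mono) auto
  then have "(w \<bullet> w) powr a * 1 \<le> (w \<bullet> w) powr a * (1 + \<delta> / 2 * (ln (w \<bullet> w) - ln (dist2_line e w)))"
    using assms by (intro mult_left_mono) auto
  then show ?thesis by (simp add: barrier_def)
qed

lemma inner_self_powr: "w \<noteq> 0 \<Longrightarrow> (w \<bullet> w) powr a = norm w powr (2 * a)"
  by (metis dot_square_norm norm_ge_zero powr_powr powr_numeral zero_le_numeral norm_eq_zero power_zero_numeral)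

text \<open>
  The linear inequality that $\overline\Gamma_k$ imposes on the Hessian, together with the
  differentiability needed for the second derivative test.
\<close>

definition cone_subsolution :: "real \<Rightarrow> (real ^ 'n) set \<Rightarrow> (real ^ 'n \<Rightarrow> real) \<Rightarrow> bool" where
  "cone_subsolution \<theta> S u \<longleftrightarrow> open S \<and>
     (\<forall>x\<in>S. u differentiable (at x) \<and> grad u differentiable (at x) \<and>
       (\<forall>e. norm e = 1 \<longrightarrow> 0 \<le> (1 - \<theta>) * (e \<bullet> (hessian u x *v e)) + \<theta> * trace (hessian u x)))"

text \<open>
  Suppose that the difference of $u$ and the multiple of the barrier exceeds $u(y)$ at $x_1$. It
  stays below its value at $x_1$ near $y$ because $u$ is continuous there, near the line because
  the barrier is large, and on the sphere $|x-y| = R$ because the power alone absorbs $N$. So it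
  has a maximum on a compact set away from all three, and this maximum is a local one. There the
  Hessian of $u$ lies below that of the barrier, which contradicts strictness, the direction $e$
  in the inequality for $u$ being taken radial.
\<close>

lemma comparison_with_barrier:
  fixes u :: "real ^ 'n \<Rightarrow> real"
  assumes subsol: "cone_subsolution \<theta> S u" and e: "norm e = 1"
    and \<theta>: "0 \<le> \<theta>" "\<theta> = 0 \<or> CARD('n) \<ge> 3" and \<delta>: "\<delta> > 0"
    and a: "0 < a" "2 * a < \<alpha>" and \<alpha>: "\<alpha> = 1 - (real CARD('n) - 1) * \<theta>"
    and small: "\<theta> * \<delta> < 2 * a * (\<alpha> - 2 * a)"
    and y: "y \<in> S" and R: "R > 0" and N: "N > 0"
    and cover: "\<And>x. x \<in> cball y R \<Longrightarrow> dist2_line e (x - y) > 0 \<Longrightarrow> x \<in> S"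
    and bound: "\<And>x. x \<in> cball y R \<Longrightarrow> dist2_line e (x - y) > 0 \<Longrightarrow> u x \<le> u y + N"
    and x1: "x1 \<in> cball y R" "dist2_line e (x1 - y) > 0"
  shows "u x1 \<le> u y + N / R powr (2 * a) * barrier a \<delta> e (x1 - y)"
proof (rule ccontr)
  from subsol have S: "open S" and u: "\<And>x. x \<in> S \<Longrightarrow> u differentiable (at x)"
    and g: "\<And>x. x \<in> S \<Longrightarrow> grad u differentiable (at x)"
    and sub: "\<And>x e. x \<in> S \<Longrightarrow> norm e = 1 \<Longrightarrow>
      (1 - \<theta>) * (e \<bullet> (hessian u x *v e)) + \<theta> * trace (hessian u x) \<ge> 0"
    by (auto simp: cone_subsolution_def)
  define c where "c = N / R powr (2 * a)"
  have c: "c > 0" using N R by (simp add: c_def)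
  let ?z = "\<lambda>x. dist2_line e (x - y)" and ?q = "\<lambda>x. (x - y) \<bullet> (x - y)" and ?b = "\<lambda>x. barrier a \<delta> e (x - y)"
  define h where "h x = u x - c * ?b x" for x
  define \<eta> where "\<eta> = h x1 - u y"
  assume "\<not> ?thesis"
  then have \<eta>: "\<eta> > 0" by (simp add: \<eta>_def h_def c_def)
  have zq: "?z x \<le> ?q x" for x by (simp add: dist2_line_def)
  have b_nonneg: "?b x \<ge> 0" if "?z x > 0" for x
    using barrier_ge_powr[OF e that, of \<delta> a] \<delta> by (meson less_imp_le order_trans powr_ge_zero)
  have "isCont u y" using differentiable_imp_continuous_within[OF u[OF y]] by simp
  then obtain r where r: "r > 0" "\<And>x. dist x y < r \<Longrightarrow> dist (u x) (u y) < \<eta>"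
    using \<eta> unfolding continuous_at_eps_delta by blast
  have near: "h x < u y + \<eta>" if "?z x > 0" "dist x y < r" for x
  proof -
    have "c * ?b x \<ge> 0" using b_nonneg[OF that(1)] c by simp
    then show ?thesis using r(2)[OF that(2)] by (simp add: h_def dist_real_def abs_less_iff)
  qed
  \<comment> \<open>Where $\ln(q/z) > \Lambda$ and $|x-y| \ge r$, the logarithmic term alone exceeds $N$.\<close>
  define \<Lambda> where "\<Lambda> = 2 * N / (\<delta> * c * r powr (2 * a))"
  have far: "h x < u y + \<eta>" if x: "x \<in> cball y R" "?z x > 0" "dist x y \<ge> r" "?z x * exp \<Lambda> < ?q x" for x
  proof -
    have xy: "x \<noteq> y" using x(3) r(1) by auto
    have qp: "?q x > 0" using xy by simp
    have "ln (?z x * exp \<Lambda>) < ln (?q x)" using x(2,4) qp by (subst ln_less_cancel_iff) auto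
    then have L: "\<Lambda> < ln (?q x) - ln (?z x)" using x(2) by (simp add: ln_mult)
    have pw: "r powr (2 * a) \<le> ?q x powr a"
      using xy x(3) r(1) a by (simp add: inner_self_powr dist_norm powr_mono2)
    have rp: "r powr (2 * a) > 0" using r(1) by simp
    have \<Lambda>0: "\<Lambda> \<ge> 0" using N \<delta> c rp by (simp add: \<Lambda>_def)
    have "N = c * (r powr (2 * a) * (\<delta> / 2 * \<Lambda>))" using \<delta> c rp r(1) by (simp add: \<Lambda>_def)
    also have "\<dots> \<le> c * (?q x powr a * (1 + \<delta> / 2 * (ln (?q x) - ln (?z x))))"
    proof (intro mult_left_mono mult_mono pw)
      have "\<delta> / 2 * \<Lambda> \<le> \<delta> / 2 * (ln (?q x) - ln (?z x))" using L \<delta> by (intro mult_left_mono) auto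
      then show "\<delta> / 2 * \<Lambda> \<le> 1 + \<delta> / 2 * (ln (?q x) - ln (?z x))" by simp
    qed (use c \<delta> \<Lambda>0 in auto)
    finally have "N \<le> c * ?b x" by (simp add: barrier_def)
    then show ?thesis using bound[OF x(1,2)] \<eta> by (simp add: h_def)
  qed
  define T where "T = cball y R \<inter> {x. r \<le> dist x y} \<inter> {x. ?q x \<le> ?z x * exp \<Lambda>}"
  have Tz: "?z x > 0" if "x \<in> T" for x
  proof -
    have "x \<noteq> y" using that r(1) by (auto simp: T_def)
    then have "0 < ?q x" by simp
    also have "\<dots> \<le> ?z x * exp \<Lambda>" using that by (simp add: T_def)
    finally show ?thesis by (simp add: zero_less_mult_iff)
  qed
  have contz: "continuous_on A ?z" for A unfolding dist2_line_def by (intro continuous_intros)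
  have "compact T" unfolding T_def Int_assoc
    by (intro compact_Int_closed compact_cball closed_Int closed_Collect_le continuous_intros contz)
  moreover have x1T: "x1 \<in> T"
    using x1 near[OF x1(2)] far[OF x1] by (force simp: T_def \<eta>_def)
  moreover have "continuous_on T h"
    unfolding h_def barrier_def
  proof (intro continuous_intros contz)
    show "continuous_on T u"
      using u cover Tz T_def
      by (intro continuous_at_imp_continuous_on ballI differentiable_imp_continuous_within) auto
    show "\<forall>x\<in>T. ?q x \<noteq> 0" "\<forall>x\<in>T. ?q x \<noteq> 0" "\<forall>x\<in>T. ?z x \<noteq> 0"
      using Tz zq by (metis less_irrefl not_less)+
  qed
  ultimately obtain x0 where x0: "x0 \<in> T" and max: "\<And>x. x \<in> T \<Longrightarrow> h x \<le> h x0"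
    using continuous_attains_sup[of T h] by blast
  have h0: "h x0 \<ge> u y + \<eta>" using max[OF x1T] by (simp add: \<eta>_def)
  have z0: "?z x0 > 0" using Tz[OF x0] .
  have in0: "x0 \<in> cball y R" using x0 by (simp add: T_def)
  have x0y: "x0 \<noteq> y" using x0 r(1) by (auto simp: T_def)
  have "dist x0 y < R"
  proof (rule ccontr)
    assume "\<not> dist x0 y < R"
    then have "norm (x0 - y) = R" using in0 by (simp add: dist_norm norm_minus_commute)
    then have "?q x0 powr a = R powr (2 * a)" using x0y inner_self_powr[of "x0 - y" a] by simp
    then have "N = c * ?q x0 powr a" using R by (simp add: c_def)
    also have "\<dots> \<le> c * ?b x0" using barrier_ge_powr[OF e z0, of \<delta> a] \<delta> c by (intro mult_left_mono) auto
    finally show False using bound[OF in0 z0] h0 \<eta> by (simp add: h_def)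
  qed
  then have "x0 \<in> ball y R \<inter> {x. ?z x > 0}" using z0 by (simp add: dist_commute)
  moreover have "open (ball y R \<inter> {x. ?z x > 0})"
    by (intro open_Int open_ball open_Collect_less continuous_on_const contz)
  ultimately have "\<forall>\<^sub>F x in nhds x0. x \<in> ball y R \<inter> {x. ?z x > 0}" by (intro eventually_nhds_in_open)
  then have locmax: "\<forall>\<^sub>F x in nhds x0. u x - c * ?b x \<le> u x0 - c * ?b x0"
  proof eventually_elim
    case (elim x)
    show ?case
    proof (cases "x \<in> T")
      case True
      then show ?thesis using max[of x] by (simp add: h_def)
    next
      case False
      then have "h x < u y + \<eta>" using elim near[of x] far[of x] by (force simp: T_def)
      then show ?thesis using h0 by (simp add: h_def)
    qed
  qed
  have x0S: "x0 \<in> S" using cover[OF in0 z0] .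
  have le: "v \<bullet> (hessian u x0 *v v) \<le> c * barrier_hessian a \<delta> e (x0 - y) v" for v
    by (rule hessian_le_barrier_hessian_at_max[OF S x0S _ g[OF x0S] z0 locmax]) (rule u)
  let ?v = "(1 / norm (x0 - y)) *\<^sub>R (x0 - y)"
  have nv: "norm ?v = 1" using x0y by simp
  have "(real CARD('n) - 1) * \<theta> < 1" using \<alpha> a by simp
  moreover have "\<theta> \<le> (real CARD('n) - 1) * \<theta>"
  proof (cases "\<theta> = 0")
    case False
    then show ?thesis using \<theta> mult_right_mono[of 1 "real CARD('n) - 1" \<theta>] by simp
  qed simp
  ultimately have th1: "1 - \<theta> \<ge> 0" by simp
  have "0 \<le> (1 - \<theta>) * (?v \<bullet> (hessian u x0 *v ?v)) + \<theta> * trace (hessian u x0)"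
    by (rule sub[OF x0S nv])
  also have "\<dots> \<le> (1 - \<theta>) * (c * barrier_hessian a \<delta> e (x0 - y) ?v)
      + \<theta> * (\<Sum>i\<in>UNIV. c * barrier_hessian a \<delta> e (x0 - y) (axis i 1))"
    unfolding trace_eq_sum_quadratic_form using th1 \<theta>(1)
    by (intro add_mono mult_left_mono sum_mono le) auto
  also have "\<dots> = c * ((1 - \<theta>) * barrier_hessian a \<delta> e (x0 - y) ?v
      + \<theta> * (\<Sum>i\<in>UNIV. barrier_hessian a \<delta> e (x0 - y) (axis i 1)))"
    by (simp add: sum_distrib_left[symmetric] distrib_left mult_ac)
  also have "\<dots> < 0"
    using barrier_strict_supersolution[OF e z0 \<theta> \<delta> a \<alpha> small] c by (intro mult_pos_neg) auto
  finally show False by simp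
qed

text \<open>
  Off the line the barrier tends to the pure power as $\delta \to 0$, after which the exponent
  $2a < \alpha$ may tend to $\alpha$.
\<close>

lemma growth_off_line:
  fixes u :: "real ^ 'n \<Rightarrow> real"
  assumes subsol: "cone_subsolution \<theta> S u" and e: "norm e = 1"
    and \<theta>: "0 \<le> \<theta>" "\<theta> = 0 \<or> CARD('n) \<ge> 3"
    and \<alpha>: "\<alpha> = 1 - (real CARD('n) - 1) * \<theta>" "\<alpha> > 0"
    and y: "y \<in> S" and R: "R > 0" and N: "N > 0"
    and cover: "\<And>x. x \<in> cball y R \<Longrightarrow> dist2_line e (x - y) > 0 \<Longrightarrow> x \<in> S"
    and bound: "\<And>x. x \<in> cball y R \<Longrightarrow> dist2_line e (x - y) > 0 \<Longrightarrow> u x \<le> u y + N"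
    and x: "x \<in> cball y R" "dist2_line e (x - y) > 0"
  shows "u x \<le> u y + N * (dist x y / R) powr \<alpha>"
proof -
  have xy: "x \<noteq> y" using x(2) by (auto simp: dist2_line_def)
  have below: "u x \<le> u y + N * (dist x y / R) powr \<beta>" if \<beta>: "0 < \<beta>" "\<beta> < \<alpha>" for \<beta>
  proof -
    let ?a = "\<beta> / 2"
    have "((\<lambda>\<delta>. u y + N / R powr (2 * ?a) * barrier ?a \<delta> e (x - y)) \<longlongrightarrow>
        u y + N / R powr (2 * ?a) * (((x - y) \<bullet> (x - y)) powr ?a * (1 + 0 / 2 *
          (ln ((x - y) \<bullet> (x - y)) - ln (dist2_line e (x - y)))))) (at_right 0)"
      unfolding barrier_def by (intro tendsto_intros) auto
    moreover have "((\<lambda>\<delta>. \<theta> * \<delta>) \<longlongrightarrow> \<theta> * 0) (at_right 0)" by (intro tendsto_intros)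
    then have "\<forall>\<^sub>F \<delta> in at_right 0. \<theta> * \<delta> < 2 * ?a * (\<alpha> - 2 * ?a)"
      using \<beta> by (intro order_tendstoD(2)) auto
    then have "\<forall>\<^sub>F \<delta> in at_right 0. u x \<le> u y + N / R powr (2 * ?a) * barrier ?a \<delta> e (x - y)"
      using eventually_at_right_less[of 0]
    proof eventually_elim
      case (elim \<delta>)
      show ?case
        by (rule comparison_with_barrier[OF subsol e \<theta> elim(2) _ _ \<alpha>(1) elim(1) y R N cover bound x])
          (use \<beta> in auto)
    qed
    ultimately have "u x \<le> u y + N / R powr (2 * ?a) * (((x - y) \<bullet> (x - y)) powr ?a * (1 + 0 / 2 *
          (ln ((x - y) \<bullet> (x - y)) - ln (dist2_line e (x - y)))))"
      by (intro tendsto_lowerbound) auto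
    then show ?thesis
      using xy R inner_self_powr[of "x - y" ?a] by (simp add: dist_norm powr_divide)
  qed
  have "((\<lambda>\<beta>. u y + N * (dist x y / R) powr \<beta>) \<longlongrightarrow> u y + N * (dist x y / R) powr \<alpha>) (at_left \<alpha>)"
    using xy R by (intro tendsto_intros) auto
  moreover have "\<forall>\<^sub>F \<beta> in at_left \<alpha>. u x \<le> u y + N * (dist x y / R) powr \<beta>"
    using eventually_at_left_real[OF \<alpha>(2)] by eventually_elim (use below in auto)
  ultimately show ?thesis by (intro tendsto_lowerbound) auto
qed

section \<open>Hoelder estimate and extension\<close>

lemma exists_off_line:
  fixes e :: "real ^ 'n"
  assumes "CARD('n) \<ge> 2" "norm e = 1"
  obtains w where "dist2_line e w > 0"
proof -
  have "\<exists>i. dist2_line e (axis i 1) > 0"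
  proof (rule ccontr)
    assume "\<not> ?thesis"
    moreover have "axis i 1 \<bullet> (axis i 1 :: real ^ 'n) = 1" "axis i 1 \<bullet> e = e $ i" for i
      by (simp_all add: inner_axis inner_axis')
    ultimately have "1 \<le> (e $ i)\<^sup>2" for i
      by (auto simp: dist2_line_def not_less)
    then have "(\<Sum>i\<in>(UNIV :: 'n set). 1) \<le> (\<Sum>i\<in>UNIV. (e $ i)\<^sup>2)" by (intro sum_mono)
    also have "\<dots> = 1" using assms(2) by (simp add: norm_eq_1 inner_vec_def power2_eq_square)
    finally show False using assms(1) by simp
  qed
  then show ?thesis using that by blast
qed

lemma dist2_line_add_on_line:
  fixes v w e :: "'a::real_inner"
  assumes e: "norm e = 1" and v: "dist2_line e v = 0"
  shows "dist2_line e (v + t *\<^sub>R w) = t\<^sup>2 * dist2_line e w"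
proof -
  have ee: "e \<bullet> e = 1" using e by (simp add: norm_eq_1)
  define s where "s = v \<bullet> e"
  have "(v - s *\<^sub>R e) \<bullet> (v - s *\<^sub>R e) = dist2_line e v"
    by (simp add: dist2_line_def s_def inner_diff_left inner_diff_right ee inner_commute[of e v] power2_eq_square)
  then have "v = s *\<^sub>R e" using v by simp
  then have "v + t *\<^sub>R w = s *\<^sub>R e + t *\<^sub>R w" by simp
  then show ?thesis
    by (simp add: dist2_line_def inner_add_left inner_add_right ee inner_commute[of e w])
      (simp add: algebra_simps power2_eq_square)
qed

text \<open>
  The excluded line is the one through $y$ and the origin, so that the comparison never meets the
  puncture. A point $x \neq 0$ on that line is a limit of points off it, and $u$ is continuous
  at $x$.
\<close>

lemma growth_punctured_ball:
  fixes u :: "real ^ 'n \<Rightarrow> real"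
  assumes n: "CARD('n) \<ge> 2" and subsol: "cone_subsolution \<theta> (ball 0 \<rho> - {0}) u"
    and \<theta>: "0 \<le> \<theta>" "\<theta> = 0 \<or> CARD('n) \<ge> 3"
    and \<alpha>: "\<alpha> = 1 - (real CARD('n) - 1) * \<theta>" "\<alpha> > 0"
    and R: "R > 0" "cball y R \<subseteq> ball 0 \<rho>" and y: "y \<noteq> 0"
    and osc: "\<And>x. x \<in> ball 0 \<rho> - {0} \<Longrightarrow> u x - u y \<le> N"
    and x: "x \<noteq> 0" "dist x y < R"
  shows "u x - u y \<le> N * (dist x y / R) powr \<alpha>"
proof -
  define e where "e = (1 / norm y) *\<^sub>R y"
  have e: "norm e = 1" using y by (simp add: e_def)
  have yS: "y \<in> ball 0 \<rho> - {0}" using subsetD[OF R(2), of y] R(1) y by simp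
  have N0: "N \<ge> 0" using osc[OF yS] by simp
  have ye: "dist2_line e (0 - y) = 0"
    using y by (simp add: dist2_line_def e_def power_divide dot_square_norm power2_eq_square)
  have cover: "x \<in> ball 0 \<rho> - {0}" if "x \<in> cball y R" "dist2_line e (x - y) > 0" for x
    using that R ye by auto
  have off: "u x - u y \<le> N * (dist x y / R) powr \<alpha>"
    if x: "x \<in> cball y R" "dist2_line e (x - y) > 0" for x
  proof -
    \<comment> \<open>The oscillation $N$ may be $0$, while the barrier needs positive height.\<close>
    have "u x \<le> u y + (N + \<epsilon>) * (dist x y / R) powr \<alpha>" if \<epsilon>: "\<epsilon> > 0" for \<epsilon>
    proof (rule growth_off_line[OF subsol e \<theta> \<alpha> yS R(1) _ cover _ x])
      show "N + \<epsilon> > 0" using N0 \<epsilon> by simp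
      fix x assume "x \<in> cball y R" "dist2_line e (x - y) > 0"
      then show "u x \<le> u y + (N + \<epsilon>)" using osc[OF cover] \<epsilon> by fastforce
    qed
    then have "\<forall>\<^sub>F \<epsilon> in at_right 0. u x \<le> u y + (N + \<epsilon>) * (dist x y / R) powr \<alpha>"
      using eventually_at_right_less[of 0] by (auto elim: eventually_mono)
    moreover have "((\<lambda>\<epsilon>. u y + (N + \<epsilon>) * (dist x y / R) powr \<alpha>) \<longlongrightarrow>
        u y + (N + 0) * (dist x y / R) powr \<alpha>) (at_right 0)"
      by (intro tendsto_intros)
    ultimately have "u x \<le> u y + (N + 0) * (dist x y / R) powr \<alpha>" by (intro tendsto_lowerbound) auto
    then show ?thesis by simp
  qed
  show ?thesis
  proof (cases "dist2_line e (x - y) > 0")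
    case True
    then show ?thesis using off[of x] x by (simp add: dist_commute)
  next
    case False
    then have on: "dist2_line e (x - y) = 0" using dist2_line_nonneg[OF e, of "x - y"] by simp
    show ?thesis
    proof (cases "x = y")
      case True
      then show ?thesis using N0 by simp
    next
      case ne: False
      obtain w where w: "dist2_line e w > 0" using exists_off_line[OF n e] .
      have xS: "x \<in> ball 0 \<rho> - {0}" using subsetD[OF R(2), of x] x by (simp add: dist_commute)
      let ?x = "\<lambda>t. x + t *\<^sub>R w"
      have lim: "(?x \<longlongrightarrow> x + 0 *\<^sub>R w) (at_right 0)" by (intro tendsto_intros)
      have "u differentiable (at x)" using subsol xS unfolding cone_subsolution_def by blast
      then have cont: "isCont u x" by (rule differentiable_imp_continuous_within)
      have lim': "(?x \<longlongrightarrow> x) (at_right 0)" using lim by simp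
      have "((\<lambda>t. u (?x t)) \<longlongrightarrow> u x) (at_right 0)"
        by (rule isCont_tendsto_compose[OF cont lim'])
      then have "((\<lambda>t. u (?x t) - u y) \<longlongrightarrow> u x - u y) (at_right 0)" by (intro tendsto_intros)
      moreover have limd: "((\<lambda>t. dist (?x t) y) \<longlongrightarrow> dist x y) (at_right 0)"
        by (intro tendsto_dist lim' tendsto_const)
      then have "((\<lambda>t. N * (dist (?x t) y / R) powr \<alpha>) \<longlongrightarrow> N * (dist x y / R) powr \<alpha>) (at_right 0)"
        using ne R by (intro tendsto_mult tendsto_const tendsto_powr tendsto_divide limd) auto
      moreover have "\<forall>\<^sub>F t in at_right 0. u (?x t) - u y \<le> N * (dist (?x t) y / R) powr \<alpha>"
        using eventually_at_right_less[of 0] order_tendstoD(2)[OF limd x(2)]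
      proof eventually_elim
        case (elim t)
        have "?x t - y = (x - y) + t *\<^sub>R w" by simp
        then have "dist2_line e (?x t - y) = t\<^sup>2 * dist2_line e w"
          using dist2_line_add_on_line[OF e on] by metis
        then have "dist2_line e (?x t - y) > 0" using w elim by simp
        then show ?case using off[of "?x t"] elim by (simp add: dist_commute)
      qed
      ultimately show ?thesis by (intro tendsto_le[OF trivial_limit_at_right_real])
    qed
  qed
qed

text \<open>
  For $|x - y| < R = (2-a)/2$ the growth bound applies in both directions; for larger
  distances the oscillation bound suffices. Finally $R^{-\alpha} \le R^{-1}$ because $R \le 1$
  and $\alpha \le 1$.
\<close>

lemma holder_punctured_ball:
  fixes u :: "real ^ 'n \<Rightarrow> real"
  assumes n: "CARD('n) \<ge> 2" and subsol: "cone_subsolution \<theta> (ball 0 2 - {0}) u"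
    and \<theta>: "0 \<le> \<theta>" "\<theta> = 0 \<or> CARD('n) \<ge> 3"
    and \<alpha>: "\<alpha> = 1 - (real CARD('n) - 1) * \<theta>" "\<alpha> > 0"
    and osc: "\<And>x y. x \<in> ball 0 2 - {0} \<Longrightarrow> y \<in> ball 0 2 - {0} \<Longrightarrow> u x - u y \<le> N"
    and a: "a < 2" "a > 0" and x: "x \<in> ball 0 a - {0}" and y: "y \<in> ball 0 a - {0}"
  shows "\<bar>u x - u y\<bar> \<le> N * (2 / (2 - a)) * dist x y powr \<alpha>"
proof -
  define R where "R = (2 - a) / 2"
  have R: "0 < R" "R \<le> 1" using a by (auto simp: R_def)
  have \<alpha>1: "\<alpha> \<le> 1" using \<alpha> \<theta> n by simp
  have cb: "cball z R \<subseteq> ball 0 2" if "z \<in> ball 0 a" for z :: "real ^ 'n"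
  proof
    fix p assume "p \<in> cball z R"
    then have "norm p \<le> norm z + R" using norm_triangle_sub[of p z] by (simp add: dist_norm norm_minus_commute)
    moreover have "norm z < a" using that by simp
    moreover have "a + R < 2" using a by (simp add: R_def field_simps)
    ultimately show "p \<in> ball 0 2" by simp
  qed
  have sub: "ball 0 a - {0} \<subseteq> ball 0 2 - {0 :: real ^ 'n}" using a by auto
  have N0: "N \<ge> 0" using osc[of x x] x sub by auto
  have one: "u p - u q \<le> N * (dist p q / R) powr \<alpha>" if p: "p \<in> ball 0 a - {0}" and q: "q \<in> ball 0 a - {0}" for p q
  proof (cases "dist p q < R")
    case True
    show ?thesis
      by (rule growth_punctured_ball[OF n subsol \<theta> \<alpha> R(1) cb _ _ _ True]) (use p q osc sub in auto)
  next
    case False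
    then have "1 \<le> (dist p q / R) powr \<alpha>" using R \<alpha> by (intro ge_one_powr_ge_zero) auto
    then have "N * 1 \<le> N * (dist p q / R) powr \<alpha>" using N0 by (intro mult_left_mono)
    then show ?thesis using osc[of p q] p q sub by fastforce
  qed
  have "\<bar>u x - u y\<bar> \<le> N * (dist x y / R) powr \<alpha>"
    using one[OF x y] one[OF y x] by (simp add: dist_commute abs_le_iff)
  also have "(dist x y / R) powr \<alpha> = (1 / R) powr \<alpha> * dist x y powr \<alpha>"
    using R by (simp add: powr_divide)
  also have "\<dots> \<le> (1 / R) powr 1 * dist x y powr \<alpha>"
    using R \<alpha>1 by (intro mult_right_mono powr_mono) auto
  finally show ?thesis using N0 R by (simp add: R_def mult_left_mono mult.assoc)
qed


lemma cone_subsolution_of_Gamma_cone: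
  fixes u :: "real ^ 'n \<Rightarrow> real"
  assumes S: "open S" and k: "2 \<le> k" "k \<le> CARD('n)" and u: "C2_on u S"
    and cone: "\<forall>x\<in>S. \<exists>l. is_eigenvalues (hessian u x) l \<and> l \<in> closure (Gamma_cone k)"
    and \<theta>: "\<theta> = (real CARD('n) - real k) / (real k * (real CARD('n) - 1))"
  shows "cone_subsolution \<theta> S u"
  unfolding cone_subsolution_def
proof (intro conjI S ballI allI impI)
  fix x assume x: "x \<in> S"
  have diff: "\<And>y. y \<in> S \<Longrightarrow> u differentiable (at y)" and gdiff: "grad u differentiable (at x)"
    using u x unfolding C2_on_def by blast+
  then show "u differentiable (at x)" "grad u differentiable (at x)" using x by auto
  fix e :: "real ^ 'n" assume e: "norm e = 1"
  obtain l where l: "is_eigenvalues (hessian u x) l" "l \<in> closure (Gamma_cone k)" using cone x by blast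
  show "0 \<le> (1 - \<theta>) * (e \<bullet> (hessian u x *v e)) + \<theta> * trace (hessian u x)"
    by (rule Gamma_cone_quadratic_form[OF k _ l e \<theta>]) (rule hessian_symmetric[OF S x diff gdiff])
qed

text \<open>
  The bounds on $|u(x) - u(y)|$ make $u$ uniformly continuous near the puncture, so it has a
  limit there, and they pass to the limit.
\<close>

lemma holder_extension_at_0:
  fixes u :: "real ^ 'n \<Rightarrow> real"
  assumes \<alpha>: "\<alpha> > 0" and holder: "\<And>a x y. 0 < a \<Longrightarrow> a < 2 \<Longrightarrow> x \<in> ball 0 a - {0} \<Longrightarrow> y \<in> ball 0 a - {0} \<Longrightarrow>
      \<bar>u x - u y\<bar> \<le> K a * dist x y powr \<alpha>"
    and range: "\<And>x. x \<in> ball 0 2 - {0} \<Longrightarrow> u x \<in> {m..M}"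
    and K: "\<And>a. 0 < a \<Longrightarrow> a < 2 \<Longrightarrow> K a \<ge> 0"
  shows "\<exists>g. (\<forall>x. x \<noteq> 0 \<longrightarrow> g x = u x) \<and> (\<forall>x \<in> ball 0 2. g x \<in> {m..M}) \<and>
    (\<forall>a. 0 < a \<and> a < 2 \<longrightarrow> (\<forall>x \<in> ball 0 a. \<forall>y \<in> ball 0 a. \<bar>g x - g y\<bar> \<le> K a * dist x y powr \<alpha>))"
proof -
  let ?X = "ball 0 1 - {0 :: real ^ 'n}"
  have "uniformly_continuous_on ?X u"
    unfolding uniformly_continuous_on_def
  proof (intro allI impI)
    fix \<epsilon> :: real assume \<epsilon>: "\<epsilon> > 0"
    have K1: "K 1 \<ge> 0" using K by simp
    define d where "d = (\<epsilon> / (K 1 + 1)) powr (1 / \<alpha>)"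
    have d: "d > 0" using \<epsilon> K1 by (simp add: d_def)
    have "dist (u y) (u x) < \<epsilon>" if "x \<in> ?X" "y \<in> ?X" "dist y x < d" for x y
    proof -
      have "dist y x powr \<alpha> \<le> d powr \<alpha>" using that \<alpha> by (intro powr_mono2) auto
      also have "d powr \<alpha> = \<epsilon> / (K 1 + 1)" using \<alpha> \<epsilon> K1 by (simp add: d_def powr_powr)
      finally have "K 1 * dist y x powr \<alpha> \<le> K 1 * (\<epsilon> / (K 1 + 1))" using K1 by (intro mult_left_mono)
      also have "\<dots> < \<epsilon>" using K1 \<epsilon> by (simp add: field_simps)
      finally show ?thesis using holder[of 1 y x] that by (simp add: dist_real_def)
    qed
    then show "\<exists>d>0. \<forall>x\<in>?X. \<forall>x'\<in>?X. dist x' x < d \<longrightarrow> dist (u x') (u x) < \<epsilon>" using d by blast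
  qed
  moreover have "0 islimpt ?X" by (simp add: islimpt_ball flip: islimpt_punctured)
  then have "0 \<in> closure ?X" by (simp add: closure_def)
  ultimately obtain c where c: "(u \<longlongrightarrow> c) (at 0 within ?X)"
    using uniformly_continuous_on_extension_at_closure[of ?X u 0] by blast
  have "at 0 within ?X = at (0 :: real ^ 'n)"
    using at_within_nhd[of 0 "ball 0 1 :: (real ^ 'n) set" ?X UNIV] by auto
  then have lim: "(u \<longlongrightarrow> c) (at 0)" using c by simp
  have near: "\<forall>\<^sub>F y in at 0. y \<in> ball 0 r - {0 :: real ^ 'n}" if "r > 0" for r
    using eventually_at_ball'[OF that, of 0 UNIV] by (auto elim: eventually_mono)
  let ?g = "\<lambda>x. if x = 0 then c else u x"
  have g0: "\<bar>u x - c\<bar> \<le> K a * dist x 0 powr \<alpha>" if a: "0 < a" "a < 2" and x: "x \<in> ball 0 a - {0}" for a x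
  proof (rule tendsto_le[OF trivial_limit_at])
    show "((\<lambda>y. \<bar>u x - u y\<bar>) \<longlongrightarrow> \<bar>u x - c\<bar>) (at 0)" by (intro tendsto_intros lim)
    show "((\<lambda>y. K a * dist x y powr \<alpha>) \<longlongrightarrow> K a * dist x 0 powr \<alpha>) (at 0)"
      using x by (intro tendsto_intros) auto
    show "\<forall>\<^sub>F y in at 0. \<bar>u x - u y\<bar> \<le> K a * dist x y powr \<alpha>"
      using near[OF a(1)] by eventually_elim (rule holder[OF a x])
  qed
  have "\<forall>\<^sub>F y in at 0. u y \<in> {m..M}" using near[of 2] range by (auto elim: eventually_mono)
  then have "c \<in> {m..M}" using lim by (intro Lim_in_closed_set[of "{m..M}" u "at 0"]) auto
  moreover have "\<bar>?g x - ?g y\<bar> \<le> K a * dist x y powr \<alpha>"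
    if "0 < a" "a < 2" "x \<in> ball 0 a" "y \<in> ball 0 a" for a x y
    using that holder[of a x y] g0[of a x] g0[of a y]
    by (auto simp: dist_commute abs_minus_commute split: if_splits)
  ultimately show ?thesis using range by (intro exI[of _ ?g]) auto
qed

lemma holder_norm_le:
  fixes f :: "'a::metric_space \<Rightarrow> real"
  assumes xy: "x \<in> S" "y \<in> S" "x \<noteq> y" and A: "\<And>x. x \<in> S \<Longrightarrow> \<bar>f x\<bar> \<le> A"
    and B: "\<And>x y. x \<in> S \<Longrightarrow> y \<in> S \<Longrightarrow> \<bar>f x - f y\<bar> \<le> B * dist x y powr \<alpha>"
  shows "holder_norm \<alpha> S f \<le> A + B"
  unfolding holder_norm_def
proof (intro add_mono)
  show "(SUP x\<in>S. \<bar>f x\<bar>) \<le> A" using xy A by (intro cSUP_least) auto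
  show "Sup {\<bar>f x - f y\<bar> / dist x y powr \<alpha> |x y. x \<in> S \<and> y \<in> S \<and> x \<noteq> y} \<le> B"
  proof (rule cSup_least)
    show "{\<bar>f x - f y\<bar> / dist x y powr \<alpha> |x y. x \<in> S \<and> y \<in> S \<and> x \<noteq> y} \<noteq> {}" using xy by blast
    fix s assume "s \<in> {\<bar>f x - f y\<bar> / dist x y powr \<alpha> |x y. x \<in> S \<and> y \<in> S \<and> x \<noteq> y}"
    then obtain p q where "p \<in> S" "q \<in> S" "p \<noteq> q" and s: "s = \<bar>f p - f q\<bar> / dist p q powr \<alpha>" by blast
    then show "s \<le> B" using B[of p q] by (simp add: pos_divide_le_eq)
  qed
qed

theorem corollary1p2:
  assumes "CARD('n::finite) \<ge> 2"
  shows "\<exists>C :: real \<Rightarrow> real. (\<forall>a. C a > 0) \<and>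
    (\<forall>(k::nat) (\<xi> :: real ^ 'n \<Rightarrow> real).
       real CARD('n) / 2 < real k \<longrightarrow> k \<le> CARD('n) \<longrightarrow>
       C2_on \<xi> (ball 0 2 - {0}) \<longrightarrow>
       bounded (\<xi> ` (ball 0 2 - {0})) \<longrightarrow>
       (\<forall>x \<in> ball 0 2 - {0}. \<exists>l. is_eigenvalues (hessian \<xi> x) l \<and> l \<in> closure (Gamma_cone k)) \<longrightarrow>
       (let \<alpha> = (2 * real k - real CARD('n)) / real k;
            M = (SUP x \<in> ball 0 2 - {0}. \<xi> x);
            m = (INF x \<in> ball 0 2 - {0}. \<xi> x)
        in \<exists>g :: real ^ 'n \<Rightarrow> real.
             (\<forall>x \<in> ball 0 2 - {0}. g x = \<xi> x) \<and>
             g \<in> holder_space \<alpha> (ball 0 1) \<and>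
             (\<forall>a. 0 < a \<and> a < 2 \<longrightarrow>
                g \<in> holder_space \<alpha> (ball 0 a) \<and>
                holder_norm \<alpha> (ball 0 a) (\<lambda>x. g x - m) \<le> C a * (M - m))))"
proof -
  let ?n = "CARD('n)" and ?B = "ball 0 2 - {0 :: real ^ 'n}"
  define C where "C a = (if a < 2 then 1 + 2 / (2 - a) else 1)" for a :: real
  have Cpos: "C a > 0" for a by (simp add: C_def add_pos_pos)
  have main: "\<exists>g. (\<forall>x \<in> ?B. g x = \<xi> x) \<and> g \<in> holder_space \<alpha> (ball 0 1) \<and>
      (\<forall>a. 0 < a \<and> a < 2 \<longrightarrow> g \<in> holder_space \<alpha> (ball 0 a) \<and>
        holder_norm \<alpha> (ball 0 a) (\<lambda>x. g x - m) \<le> C a * (M - m))"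
    if k: "real ?n / 2 < real k" "k \<le> ?n" and C2: "C2_on \<xi> ?B" and bdd: "bounded (\<xi> ` ?B)"
      and cone: "\<forall>x \<in> ?B. \<exists>l. is_eigenvalues (hessian \<xi> x) l \<and> l \<in> closure (Gamma_cone k)"
      and \<alpha>: "\<alpha> = (2 * real k - real ?n) / real k"
      and M: "M = (SUP x \<in> ?B. \<xi> x)" and m: "m = (INF x \<in> ?B. \<xi> x)"
    for k \<xi> \<alpha> M m
  proof -
    define \<theta> where "\<theta> = (real ?n - real k) / (real k * (real ?n - 1))"
    have k2: "2 \<le> k" using k assms by simp
    have n1: "real ?n - 1 > 0" using assms by simp
    have th0: "0 \<le> \<theta>" using k n1 by (simp add: \<theta>_def)
    have th3: "\<theta> = 0 \<or> ?n \<ge> 3"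
    proof (cases "?n = 2")
      case True
      then show ?thesis using k k2 by (simp add: \<theta>_def)
    qed (use assms in simp)
    have "(real ?n - 1) * \<theta> = (real ?n - real k) / real k" using n1 by (simp add: \<theta>_def)
    then have \<alpha>\<theta>: "\<alpha> = 1 - (real ?n - 1) * \<theta>" using k2 unfolding \<alpha> by (simp add: field_simps)
    have \<alpha>0: "\<alpha> > 0" using k k2 by (simp add: \<alpha>)
    have S: "open ?B" by auto
    have subsol: "cone_subsolution \<theta> ?B \<xi>"
      by (rule cone_subsolution_of_Gamma_cone[OF S k2 k(2) C2 cone \<theta>_def])
    have range: "\<xi> x \<in> {m..M}" if "x \<in> ?B" for x
      using bdd that unfolding M m
      by (auto intro!: cSUP_upper cINF_lower bounded_imp_bdd_above bounded_imp_bdd_below)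
    have osc: "\<xi> x - \<xi> y \<le> M - m" if "x \<in> ?B" "y \<in> ?B" for x y
      using range[OF that(1)] range[OF that(2)] by simp
    define p where "p = (axis (SOME i. True) 1 :: real ^ 'n)"
    have p: "norm p = 1" by (simp add: p_def)
    then have "p \<in> ?B" by auto
    then have Mm: "M - m \<ge> 0" using osc[of p p] by simp
    let ?K = "\<lambda>a. (M - m) * (2 / (2 - a))"
    have holder: "\<bar>\<xi> x - \<xi> y\<bar> \<le> ?K a * dist x y powr \<alpha>"
      if "0 < a" "a < 2" "x \<in> ball 0 a - {0}" "y \<in> ball 0 a - {0}" for a x y
      by (rule holder_punctured_ball[OF assms subsol th0 th3 \<alpha>\<theta> \<alpha>0 osc that(2,1,3,4)])
    have K: "?K a \<ge> 0" if "0 < a" "a < 2" for a using Mm that by simp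
    have "\<exists>g. (\<forall>x. x \<noteq> 0 \<longrightarrow> g x = \<xi> x) \<and> (\<forall>x \<in> ball 0 2. g x \<in> {m..M}) \<and>
      (\<forall>a. 0 < a \<and> a < 2 \<longrightarrow> (\<forall>x \<in> ball 0 a. \<forall>y \<in> ball 0 a. \<bar>g x - g y\<bar> \<le> ?K a * dist x y powr \<alpha>))"
      by (rule holder_extension_at_0[OF \<alpha>0]) (fact holder, fact range, fact K)
    then obtain g where g: "\<And>x. x \<noteq> 0 \<Longrightarrow> g x = \<xi> x" "\<And>x. x \<in> ball 0 2 \<Longrightarrow> g x \<in> {m..M}"
      and gh: "\<And>a x y. 0 < a \<Longrightarrow> a < 2 \<Longrightarrow> x \<in> ball 0 a \<Longrightarrow> y \<in> ball 0 a \<Longrightarrow>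
        \<bar>g x - g y\<bar> \<le> ?K a * dist x y powr \<alpha>"
      by metis
    have space: "g \<in> holder_space \<alpha> (ball 0 a)" if a: "0 < a" "a < 2" for a
    proof -
      have "g ` ball 0 a \<subseteq> {m..M}" using g(2) a by fastforce
      then have "bounded (g ` ball 0 a)" using bounded_subset bounded_closed_interval by blast
      then show ?thesis using gh[OF a] unfolding holder_space_def by blast
    qed
    have norm: "holder_norm \<alpha> (ball 0 a) (\<lambda>x. g x - m) \<le> C a * (M - m)" if a: "0 < a" "a < 2" for a
    proof -
      have "holder_norm \<alpha> (ball 0 a) (\<lambda>x. g x - m) \<le> (M - m) + ?K a"
      proof (rule holder_norm_le)
        show "0 \<in> ball 0 a" "(a / 2) *\<^sub>R p \<in> ball 0 a" "0 \<noteq> (a / 2) *\<^sub>R p" using a p by auto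
        show "\<bar>g x - m\<bar> \<le> M - m" if "x \<in> ball 0 a" for x using g(2)[of x] that a by auto
        show "\<bar>(g x - m) - (g y - m)\<bar> \<le> ?K a * dist x y powr \<alpha>" if "x \<in> ball 0 a" "y \<in> ball 0 a" for x y
          using gh[OF a that] by simp
      qed
      also have "\<dots> = (1 + 2 / (2 - a)) * (M - m)" 
        by (simp only: distrib_left mult_1_right mult.commute[of "1 + 2 / (2 - a)" "M - m"])
      also have "1 + 2 / (2 - a) = C a" using a by (simp add: C_def)
      finally show ?thesis .
    qed
    show ?thesis using g(1) space norm by (intro exI[of _ g]) auto
  qed
  show ?thesis
    unfolding Let_def using Cpos main by (intro exI[of _ C] conjI allI impI) (blast | simp)+
qed

end
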